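(* Let $0<\lambda\le\Lambda<\infty$, and let $\mathcal{M}^{\pm}_{\lambda,\Lambda}$ be the Pucci operators defined in the context. Let $f:\mathbf{R}\to\mathbf{R}$ satisfy: (f1) $f\in C^1(\mathbf{R})$ and $f(s)=0$ for all $s\le 0$; (f2) there exists $\eta_0>0$ such that $\lim_{s\to 0^+}s^{-1-\eta_0}f(s)=0$; (f3) as $s\to\infty$, $f(s)/s\to\infty$, and there is a function $\bar f:(0,1]\to\mathbf{R}$ such that $f(\theta s)/f(s)\to\bar f(\theta)$ uniformly for $\theta$ in compact subsets of $(0,1]$; (f4) $s\mapsto s^{-1}f(s)$ is strictly increasing on $(0,\infty)$. Let $V:\mathbf{R}\to\mathbf{R}$ satisfy: (V1) $V\in W^{1,\infty}(\mathbf{R})$ and $\inf_{\mathbf{R}}V>0$; (V2) $V'(x)\le 0\le V'(y)$ for a.a. $x\in(-\infty,0)$ and a.a. $y\in(0,\infty)$; and suppose that the limit $V_\infty:=\lim_{|x|\to\infty}V(x)$ exists and $V(0)\le V_\infty$. (+) If there exist $C_0,\xi_0>0$ such that $$0\le V_\infty-V(x)\le C_0\exp\left(-2\sqrt{\frac{V_\infty}{\Lambda}+\xi_0}\,|x|\right)\quad\text{for all }x\in\mathbf{R},$$ then there exists a solution $u$ of $$-\mathcal{M}^{+}_{\lambda,\Lambda}(u'')+V(x)u=f(u)\ \text{ in }\mathbf{R},\qquad u>0\ \text{ in }\mathbf{R},\qquad \lim_{|x|\to\infty}u(x)=0.$$ (−) If there exist $C_0,\xi_0>0$ such that $$0\le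 V_\infty-V(x)\le C_0\exp\left(-2\sqrt{\frac{V_\infty}{\lambda}+\xi_0}\,|x|\right)\quad\text{for all }x\in\mathbf{R},$$ then there exists a solution $u$ of $$-\mathcal{M}^{-}_{\lambda,\Lambda}(u'')+V(x)u=f(u)\ \text{ in }\mathbf{R},\qquad u>0\ \text{ in }\mathbf{R},\qquad \lim_{|x|\to\infty}u(x)=0.$$
   Context: For $0<\lambda\le\Lambda<\infty$ the Pucci operators are the functions on $\mathbf{R}$ given by $\mathcal{M}^+_{\lambda,\Lambda}(s)=\Lambda s$ if $s\ge 0$ and $\lambda s$ if $s<0$; $\mathcal{M}^-_{\lambda,\Lambda}(s)=\lambda s$ if $s\ge 0$ and $\Lambda s$ if $s<0$. Functions in $W^{1,\infty}(\mathbf{R})$ are identified with their bounded Lipschitz continuous representatives. A solution is a classical one: $u\in C^2(\mathbf{R})$ and the equation holds at every point. *)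

theory Defs
  imports "HOL-Analysis.Analysis"
begin

definition pucci_plus :: "real \<Rightarrow> real \<Rightarrow> real \<Rightarrow> real" where
  "pucci_plus lam Lam s = (if s \<ge> 0 then Lam * s else lam * s)"

definition pucci_minus :: "real \<Rightarrow> real \<Rightarrow> real \<Rightarrow> real" where
  "pucci_minus lam Lam s = (if s \<ge> 0 then lam * s else Lam * s)"

(* The space W^{1,infinity}(R), each class being identified with its bounded
   Lipschitz continuous representative. *)
definition W1_inf :: "(real \<Rightarrow> real) set" where
  "W1_inf = {V. bounded (range V) \<and> (\<exists>L. L-lipschitz_on UNIV V)}"

definition C2_real :: "(real \<Rightarrow> real) \<Rightarrow> bool" where
  "C2_real u \<longleftrightarrow> u C1_differentiable_on UNIV \<and> deriv u C1_differentiable_on UNIV"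

definition classical_solution ::
    "(real \<Rightarrow> real) \<Rightarrow> (real \<Rightarrow> real) \<Rightarrow> (real \<Rightarrow> real) \<Rightarrow> (real \<Rightarrow> real) \<Rightarrow> bool" where
  "classical_solution M V f u \<longleftrightarrow>
     C2_real u \<and> (\<forall>x. - M (deriv (deriv u) x) + V x * u x = f (u x))"

end

(* Inverting the Pucci operator turns the equation into u'' = g(V(x), u) with g(v, s) = G(v s - f s)
   for a two-slope function G.  With Phi(v, .) the primitive of g(v, .), the energy
   u'^2/2 - Phi(V(x), u) increases on x <= 0 and decreases on x >= 0, while the limit energy
   u'^2/2 - Phi(Vinf, u) moves in the opposite direction to u.  From -R one shoots with zero limit
   energy and height c in (0, K], where K is the first zero of Phi(Vinf, .).  The heights for which
   u crosses zero and those for which the energy becomes negative form disjoint open sets; small c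
   lie in the second, c = K does not, so by connectedness some c lies in neither.  The limit
   R -> infinity is nontrivial because a solution that is small near the minimum of V loses
   energy there.  It is homoclinic to 0 because at infinity both energies tend to 0 and u is
   eventually monotone. *)

theory Submission
  imports Defs
begin


section \<open>Real analysis\<close>

text \<open>The target is a positive solution in the strip where the limit energy is at most 0 and
  the energy for V(x) is at least 0. The first bound gives u \<le> K, so the nonlinearity can be
  truncated at K and all initial value problems are global. The second makes Phi(V, u) \<le> 0 at a
  critical point; monotonicity of f(s)/s turns this into u'' < 0, so every critical point is a
  strict maximum and u cannot oscillate. Both bounds are closed and survive R -> infinity; strict
  positivity is open and is the one property that must be recovered in the limit. Near u = 0 the
  quotient f(u)/u is small, so V u - f(u) is positive and one slope of G acts. There Phi is exactly
  affine in V with coefficient proportional to u^2, which makes the energy lost in the well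
  comparable with the gap between the two energies far out. A constant V offers no such loss; then
  the orbit through (K, 0) is taken directly. V is Lipschitz but perhaps not differentiable, so the
  energy for V(x) is compared on short intervals with energies whose potential is frozen.\<close>

lemma continuous_induct_neg:
  fixes w :: "real \<Rightarrow> real"
  assumes "a \<le> b" "continuous_on {a..b} w" "w a < 0"
    and step: "\<And>z. a \<le> z \<Longrightarrow> z \<le> b \<Longrightarrow> (\<And>t. a \<le> t \<Longrightarrow> t \<le> z \<Longrightarrow> w t \<le> 0) \<Longrightarrow> w z < 0"
  shows "w b < 0"
proof (rule ccontr)
  assume "\<not> w b < 0"
  \<comment> \<open>At its first nonnegative point \<open>z\<close>, \<open>w\<close> is at most 0
    by the intermediate value theorem; the step hypothesis, which improves a weak bound to a strict
    one, then contradicts the choice of \<open>z\<close>.\<close>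
  let ?S = "{a..b} \<inter> w -` {0..}"
  have "compact ?S"
    by (rule closedin_compact[OF compact_Icc continuous_closedin_preimage[OF assms(2) closed_atLeast]])
  moreover have "?S \<noteq> {}" using \<open>\<not> w b < 0\<close> \<open>a \<le> b\<close> by auto
  ultimately obtain z where z: "z \<in> ?S" "\<And>t. t \<in> ?S \<Longrightarrow> z \<le> t"
    using compact_attains_inf by (metis (no_types, lifting))
  have before: "w t < 0" if "a \<le> t" "t < z" for t
    using z(2)[of t] z(1) that by (force simp: not_le)
  have "a < z" using z(1) \<open>w a < 0\<close> by (cases "a = z") auto
  have "w z \<le> 0"
  proof (rule ccontr)
    assume "\<not> w z \<le> 0"
    moreover have "continuous_on {a..z} w"
      using assms(2) z(1) by (auto intro: continuous_on_subset)
    ultimately obtain t where "a \<le> t" "t \<le> z" "w t = 0"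
      using IVT'[of w a 0 z] \<open>a < z\<close> \<open>w a < 0\<close> by auto
    then show False using before[of t] \<open>\<not> w z \<le> 0\<close> by (cases "t = z") auto
  qed
  then have "w t \<le> 0" if "a \<le> t" "t \<le> z" for t
    using before[of t] that by (cases "t = z") auto
  with step[of z] z(1) show False by auto
qed

text \<open>Over \<open>n\<close> equal pieces, increments of quadratic size add up to order 1/n.
  This replaces the derivative test for the energy with moving potential, which need not be
  differentiable.\<close>

lemma nonincreasing_if_quadratic_increments:
  fixes \<phi> :: "real \<Rightarrow> real"
  assumes "a \<le> b" and incr: "\<And>s t. a \<le> s \<Longrightarrow> s \<le> t \<Longrightarrow> t \<le> b \<Longrightarrow> \<phi> t - \<phi> s \<le> C * (t - s)\<^sup>2"
  shows "\<phi> b \<le> \<phi> a"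
proof -
  have est: "\<phi> b - \<phi> a \<le> C * (b - a)\<^sup>2 / real n" if "n > 0" for n :: nat
  proof -
    define p where "p k = a + real k * ((b - a) / real n)" for k
    have p: "p 0 = a" "p n = b" "\<And>k. p (Suc k) - p k = (b - a) / real n"
      using that by (auto simp: p_def field_simps)
    have mono: "a \<le> p k" for k using \<open>a \<le> b\<close> by (simp add: p_def)
    have "\<phi> b - \<phi> a = (\<Sum>k<n. \<phi> (p (Suc k)) - \<phi> (p k))"
      using p(1,2) sum_lessThan_telescope[of "\<lambda>k. \<phi> (p k)" n] by simp
    also have "\<dots> \<le> (\<Sum>k<n. C * ((b - a) / real n)\<^sup>2)"
    proof (rule sum_mono)
      fix k assume "k \<in> {..<n}"
      then have "real (Suc k) / real n * (b - a) \<le> 1 * (b - a)"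
        using \<open>a \<le> b\<close> by (intro mult_right_mono) (auto simp: divide_simps)
      then have "p (Suc k) \<le> b" by (simp add: p_def field_simps)
      moreover have "p k \<le> p (Suc k)" using p(3)[of k] \<open>a \<le> b\<close>
        by (metis diff_ge_0_iff_ge divide_nonneg_nonneg of_nat_0_le_iff)
      ultimately show "\<phi> (p (Suc k)) - \<phi> (p k) \<le> C * ((b - a) / real n)\<^sup>2"
        using incr[of "p k" "p (Suc k)"] mono[of k] p(3)[of k] by simp
    qed
    also have "\<dots> = C * (b - a)\<^sup>2 / real n"
      using that by (simp add: power2_eq_square field_simps)
    finally show ?thesis .
  qed
  have "(\<lambda>n. C * (b - a)\<^sup>2 / real n) \<longlonglongrightarrow> 0"
    by (rule lim_const_over_n)
  moreover have "eventually (\<lambda>n. \<phi> b - \<phi> a \<le> C * (b - a)\<^sup>2 / real n) sequentially"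
    by (rule eventually_mono[OF eventually_gt_at_top[of 0]]) (rule est)
  ultimately have "\<phi> b - \<phi> a \<le> 0"
    by (metis tendsto_lowerbound trivial_limit_sequentially)
  then show ?thesis by simp
qed

text \<open>Off an open set \<open>U\<close> of small measure the increments are almost nonnegative, and on \<open>U\<close>
  the Lipschitz constant controls them; both bounds are additive over adjacent intervals, so the
  Bolzano principle globalises them.\<close>

lemma lipschitz_mono_if_AE_deriv_nonneg:
  fixes V :: "real \<Rightarrow> real"
  assumes lip: "L-lipschitz_on UNIV V"
    and ae: "AE z in lborel. z \<in> {x..y} \<longrightarrow> (\<exists>D\<ge>0. (V has_real_derivative D) (at z))"
    and "x \<le> y"
  shows "V x \<le> V y"
proof -
  have L0: "L \<ge> 0" using lip by (rule lipschitz_on_nonneg)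
  from ae obtain N where N: "{z \<in> space lborel. \<not> (z \<in> {x..y} \<longrightarrow> (\<exists>D\<ge>0. (V has_real_derivative D) (at z)))} \<subseteq> N"
    "emeasure lborel N = 0" "N \<in> sets lborel"
    by (rule AE_E)
  have "V x - V y \<le> e * (y - x + L)" if "e > 0" for e :: real
  proof -
    obtain U where U: "open U" "N \<subseteq> U" "emeasure lborel (U - N) < e"
    proof (rule outer_regular_lborel)
      show "N \<in> sets borel" using N(3) by simp
    qed (rule \<open>e > 0\<close>)
    have "emeasure lborel U \<le> emeasure lborel ((U - N) \<union> N)"
      using U N by (intro emeasure_mono) auto
    also have "\<dots> \<le> emeasure lborel (U - N) + emeasure lborel N"
      using U N by (intro emeasure_subadditive) auto
    finally have Ue: "emeasure lborel U < e" using U N by simp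
    let ?m = "\<lambda>s t. measure lborel (U \<inter> {s<..t})"
    have fm: "U \<inter> {s<..t} \<in> fmeasurable lborel" for s t
    proof (rule fmeasurableI2)
      show "U \<in> fmeasurable lborel"
        using U(1) less_trans[OF Ue ennreal_less_top] by (intro fmeasurableI) auto
    qed (use U(1) in auto)
    \<comment> \<open>Half-open intervals make the measure term exactly additive when two adjacent
      intervals are joined.\<close>
    let ?P = "\<lambda>s t. s \<le> t \<longrightarrow> V t - V s \<ge> - e * (t - s) - L * ?m s t"
    have "?P x y"
    proof (rule Bolzano[where P = ?P])
      show "x \<le> y" by fact
    next
      fix r s t assume *: "?P r s" "?P s t" "r \<le> s" "s \<le> t"
      have "U \<inter> {r<..t} = (U \<inter> {r<..s}) \<union> (U \<inter> {s<..t})" using * by auto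
      moreover have "U \<inter> {r<..s} \<inter> (U \<inter> {s<..t}) = {}" by auto
      ultimately have "?m r t = ?m r s + ?m s t"
        using measure_Union[of lborel "U \<inter> {r<..s}" "U \<inter> {s<..t}"]
          fmeasurableD2[OF fm] fmeasurableD[OF fm] by auto
      with * show "?P r t" by (simp add: algebra_simps)
    next
      fix z assume z: "x \<le> z" "z \<le> y"
      show "\<exists>d>0. \<forall>s t. s \<le> z \<and> z \<le> t \<and> t - s < d \<longrightarrow> ?P s t"
      proof (cases "z \<in> U")
        case True
        then obtain d where d: "d > 0" "ball z d \<subseteq> U" using U(1) by (meson openE)
        have "?P s t" if "s \<le> z" "z \<le> t" "t - s < d" for s t
        proof
          assume "s \<le> t"
          have "{s<..t} \<subseteq> ball z d" using that by (auto simp: dist_real_def)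
          then have "U \<inter> {s<..t} = {s<..t}" using d by auto
          then have "?m s t = t - s" using \<open>s \<le> t\<close> by simp
          moreover have "\<bar>V t - V s\<bar> \<le> L * (t - s)"
            using lipschitz_onD[OF lip, of t s] \<open>s \<le> t\<close> by (simp add: dist_real_def)
          moreover have "0 \<le> e * (t - s)" using \<open>e > 0\<close> \<open>s \<le> t\<close> by simp
          ultimately show "V t - V s \<ge> - e * (t - s) - L * ?m s t" by (simp; linarith)
        qed
        then show ?thesis using d(1) by blast
      next
        case False
        then have "z \<notin> N" using U by auto
        moreover have "z \<in> {x..y}" using z by simp
        ultimately have "\<exists>D\<ge>0. (V has_real_derivative D) (at z)"
          using N(1) by (auto simp: subset_eq)
        then obtain D where D: "D \<ge> 0" "(V has_real_derivative D) (at z)" by blast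
        obtain d where d: "d > 0" "\<And>h. h \<noteq> z \<Longrightarrow> \<bar>h - z\<bar> < d \<Longrightarrow> \<bar>(V h - V z) / (h - z) - D\<bar> < e"
          using D(2) \<open>e > 0\<close> unfolding has_field_derivative_iff LIM_def by (auto simp: dist_real_def)
        have low: "(V h - V z) / (h - z) \<ge> - e" if "h \<noteq> z" "\<bar>h - z\<bar> < d" for h
          using d(2)[OF that] D(1) by linarith
        have up: "V t - V z \<ge> - e * (t - z)" if "z \<le> t" "t - z < d" for t
          using low[of t] that by (cases "t = z") (auto simp: divide_simps split: if_splits)
        have dn: "V z - V s \<ge> - e * (z - s)" if "s \<le> z" "z - s < d" for s
          using low[of s] that by (cases "s = z") (auto simp: divide_simps algebra_simps split: if_splits)
        have "?P s t" if "s \<le> z" "z \<le> t" "t - s < d" for s t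
        proof
          have "V t - V s \<ge> - e * (t - s)"
            using up[of t] dn[of s] that by (simp add: algebra_simps)
          moreover have "L * ?m s t \<ge> 0" using L0 by simp
          ultimately show "V t - V s \<ge> - e * (t - s) - L * ?m s t" by linarith
        qed
        then show ?thesis using d(1) by blast
      qed
    qed
    moreover have "?m x y \<le> e"
    proof -
      have "emeasure lborel (U \<inter> {x<..y}) \<le> emeasure lborel U"
        using U(1) by (intro emeasure_mono) auto
      then have "emeasure lborel (U \<inter> {x<..y}) \<le> ennreal e" using Ue by simp
      then show ?thesis using \<open>e > 0\<close> by (simp add: measure_def enn2real_leI)
    qed
    ultimately show ?thesis
      using \<open>x \<le> y\<close> L0 mult_left_mono[of "?m x y" e L] by (simp add: algebra_simps)
  qed
  then have "V x - V y \<le> 0"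
  proof -
    assume *: "\<And>e. e > 0 \<Longrightarrow> V x - V y \<le> e * (y - x + L)"
    have pos: "y - x + L + 1 > 0" using L0 \<open>x \<le> y\<close> by linarith
    show ?thesis
    proof (rule field_le_epsilon)
      fix \<epsilon> :: real assume "\<epsilon> > 0"
      then have "V x - V y \<le> \<epsilon> / (y - x + L + 1) * (y - x + L)" using pos by (intro *) auto
      also have "\<dots> \<le> \<epsilon>" using pos \<open>\<epsilon> > 0\<close> by (simp add: divide_simps)
      finally show "V x - V y \<le> 0 + \<epsilon>" by simp
    qed
  qed
  then show ?thesis by simp
qed

text \<open>Choosing an antiderivative on the whole line, rather than integrating, avoids orienting
  integrals at negative arguments. The choice is meaningful for continuous \<open>h\<close>.\<close>

definition prim :: "(real \<Rightarrow> real) \<Rightarrow> real \<Rightarrow> real" where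
  "prim h = (SOME H. H 0 = 0 \<and> (\<forall>x. (H has_real_derivative h x) (at x)))"

lemma prim:
  assumes "continuous_on UNIV h"
  shows "prim h 0 = 0" "(prim h has_real_derivative h x) (at x)"
proof -
  have "\<exists>F. \<forall>x::real. -\<infinity> < ereal x \<longrightarrow> ereal x < \<infinity> \<longrightarrow> (F has_vector_derivative h x) (at x)"
    using assms by (intro einterval_antiderivative) (auto simp: continuous_on_eq_continuous_at)
  then obtain F where "\<And>x. (F has_real_derivative h x) (at x)"
    by (auto simp: has_real_derivative_iff_has_vector_derivative)
  then have "\<exists>H. H 0 = 0 \<and> (\<forall>x. (H has_real_derivative h x) (at x))"
    by (intro exI[of _ "\<lambda>x. F x - F 0"]) (auto intro!: derivative_eq_intros)
  from someI_ex[OF this] show "prim h 0 = 0" "(prim h has_real_derivative h x) (at x)"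
    unfolding prim_def by blast+
qed

lemma DERIV_mono_le:
  fixes F G :: "real \<Rightarrow> real"
  assumes "a \<le> b" "F a \<le> G a"
    and "\<And>t. (F has_real_derivative F' t) (at t)" "\<And>t. (G has_real_derivative G' t) (at t)"
    and "\<And>t. a \<le> t \<Longrightarrow> t \<le> b \<Longrightarrow> F' t \<le> G' t"
  shows "F b \<le> G b"
proof -
  have "(\<lambda>t. G t - F t) a \<le> (\<lambda>t. G t - F t) b"
  proof (rule DERIV_nonneg_imp_nondecreasing[OF \<open>a \<le> b\<close>])
    fix t assume "a \<le> t" "t \<le> b"
    then show "\<exists>y. ((\<lambda>t. G t - F t) has_real_derivative y) (at t) \<and> 0 \<le> y"
      using assms(5)[of t] by (intro exI[of _ "G' t - F' t"]) (auto intro!: derivative_intros assms)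
  qed
  then show ?thesis using assms(2) by simp
qed


section \<open>Second-order equations on the line\<close>

lemma abs_antideriv_le:
  fixes H K :: "real \<Rightarrow> real"
  assumes "\<And>t. (H has_real_derivative h t) (at t)" "\<And>t. (K has_real_derivative k t) (at t)"
    and "H 0 = 0" "K 0 = 0" "\<And>t. 0 \<le> t \<Longrightarrow> \<bar>h t\<bar> \<le> k t" "0 \<le> x"
  shows "\<bar>H x\<bar> \<le> K x"
proof -
  have "H x \<le> K x"
    by (rule DERIV_mono_le[OF \<open>0 \<le> x\<close> _ assms(1,2)]) (use assms in \<open>auto simp: abs_le_iff\<close>)
  moreover have "- H x \<le> K x"
    by (rule DERIV_mono_le[of 0 x "\<lambda>x. - H x" K "\<lambda>x. - h x" k])
      (use assms in \<open>auto intro!: derivative_intros simp: abs_le_iff\<close>)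
  ultimately show ?thesis by (simp add: abs_le_iff)
qed

text \<open>Each integration of the hyperbolic weight gains a factor \<open>1 / M\<close>; the
  product of the two gains becomes the contraction factor of the weighted Picard map.\<close>

lemma abs_second_antideriv_le_nonneg:
  fixes P :: "real \<Rightarrow> real"
  assumes P: "\<And>t. (P has_real_derivative H t) (at t)" "\<And>t. (H has_real_derivative h t) (at t)"
    and "P 0 = 0" "H 0 = 0" and h: "\<And>t. \<bar>h t\<bar> \<le> C * cosh (M * t)" and "M > 0" "0 \<le> x"
  shows "\<bar>P x\<bar> \<le> C / M\<^sup>2 * (cosh (M * x) - 1)"
proof (rule abs_antideriv_le[OF P(1)])
  fix t :: real assume "0 \<le> t"
  show "\<bar>H t\<bar> \<le> C / M * sinh (M * t)"
    by (rule abs_antideriv_le[OF P(2), where k = "\<lambda>t. C * cosh (M * t)"])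
      (use assms \<open>0 \<le> t\<close> in \<open>auto intro!: derivative_eq_intros\<close>)
next
  show "((\<lambda>t. C / M\<^sup>2 * (cosh (M * t) - 1)) has_real_derivative C / M * sinh (M * t)) (at t)" for t
    using \<open>M > 0\<close> by (auto intro!: derivative_eq_intros simp: power2_eq_square)
qed (use assms in auto)

lemma abs_second_antideriv_le:
  fixes P :: "real \<Rightarrow> real"
  assumes P: "\<And>t. (P has_real_derivative H t) (at t)" "\<And>t. (H has_real_derivative h t) (at t)"
    and P0: "P 0 = 0" "H 0 = 0" and h: "\<And>t. \<bar>h t\<bar> \<le> C * cosh (M * t)" and "M > 0"
  shows "\<bar>P x\<bar> \<le> C / M\<^sup>2 * cosh (M * x)"
proof -
  have C: "C \<ge> 0" using h[of 0] by (simp add: order_trans[OF abs_ge_zero])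
  have "\<bar>P x\<bar> \<le> C / M\<^sup>2 * (cosh (M * x) - 1)"
  proof (cases "x \<ge> 0")
    case True
    from abs_second_antideriv_le_nonneg[OF P P0 h \<open>M > 0\<close> this] show ?thesis .
  next
    case False
    have P1: "((\<lambda>t. P (- t)) has_real_derivative - H (- t)) (at t)" for t
      using P(1)[of "- t"] by (simp only: DERIV_mirror)
    have P2: "((\<lambda>t. - H (- t)) has_real_derivative h (- t)) (at t)" for t
      using DERIV_minus[OF P(2)[of "- t", unfolded DERIV_mirror]] by simp
    have "\<bar>P (- (- x))\<bar> \<le> C / M\<^sup>2 * (cosh (M * - x) - 1)"
      by (rule abs_second_antideriv_le_nonneg[OF P1 P2 _ _ _ \<open>M > 0\<close>])
        (use P0 h[of "- _"] False in auto)
    then show ?thesis by simp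
  qed
  also have "\<dots> \<le> C / M\<^sup>2 * cosh (M * x)" using C by (intro mult_left_mono) auto
  finally show ?thesis .
qed

text \<open>Places the linear part \<open>\<beta> * x\<close> of the Picard map in the weighted
  space.\<close>

lemma abs_le_cosh: "\<bar>y\<bar> \<le> cosh y" for y :: real
proof -
  have "\<bar>\<bar>y\<bar>\<bar> \<le> sinh \<bar>y\<bar>"
    by (rule abs_antideriv_le[where h = "\<lambda>_. 1" and k = cosh])
      (auto intro!: derivative_eq_intros simp: cosh_real_ge_1)
  also have "\<dots> \<le> cosh \<bar>y\<bar>" by (simp add: sinh_def cosh_def)
  finally show ?thesis by simp
qed

text \<open>Picard iteration for \<open>u = cosh (M x) w\<close> with \<open>w\<close> bounded: for \<open>M\<^sup>2 = 2 L\<close> the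
  weight turns the global problem into a contraction with factor \<open>1/2\<close>.\<close>

lemma second_order_ode_exists:
  fixes F :: "real \<Rightarrow> real \<Rightarrow> real"
  assumes cont: "\<And>u. continuous_on UNIV u \<Longrightarrow> continuous_on UNIV (\<lambda>x. F x (u x))"
    and lip: "\<And>x s t. \<bar>F x s - F x t\<bar> \<le> L * \<bar>s - t\<bar>" and F0: "\<And>x. F x 0 = 0" and "L > 0"
  shows "\<exists>u w. u 0 = \<alpha> \<and> w 0 = \<beta> \<and> (\<forall>x. (u has_real_derivative w x) (at x)
    \<and> (w has_real_derivative F x (u x)) (at x))"
proof -
  define M where "M = sqrt (2 * L)"
  have M: "M > 0" "M\<^sup>2 = 2 * L" using \<open>L > 0\<close> by (auto simp: M_def)
  define N where "N w x = F x (cosh (M * x) * w x)" for w :: "real \<Rightarrow> real" and x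
  define T where "T w x = (\<alpha> + \<beta> * x + prim (prim (N w)) x) / cosh (M * x)" for w x
  have Nc: "continuous_on UNIV (N w)" if "continuous_on UNIV w" for w
    unfolding N_def using that by (intro cont continuous_intros)
  have pNc: "continuous_on UNIV (prim (N w))" if "continuous_on UNIV w" for w
    by (rule DERIV_continuous_on, rule DERIV_subset[OF prim(2)[OF Nc[OF that]]]) auto
  have ppNc: "continuous_on UNIV (prim (prim (N w)))" if "continuous_on UNIV w" for w
    by (rule DERIV_continuous_on, rule DERIV_subset[OF prim(2)[OF pNc[OF that]]]) auto
  have contr: "\<bar>prim (prim (N w)) x - prim (prim (N v)) x\<bar> \<le> 1/2 * B * cosh (M * x)"
    if w: "continuous_on UNIV w" and v: "continuous_on UNIV v" and B: "\<And>x. \<bar>w x - v x\<bar> \<le> B" for w v B x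
  proof -
    have "\<bar>prim (prim (N w)) x - prim (prim (N v)) x\<bar> \<le> (L * B) / M\<^sup>2 * cosh (M * x)"
    proof (rule abs_second_antideriv_le[where H = "\<lambda>x. prim (N w) x - prim (N v) x" and h = "\<lambda>x. N w x - N v x"
          and P = "\<lambda>x. prim (prim (N w)) x - prim (prim (N v)) x"])
      fix t
      have "\<bar>N w t - N v t\<bar> \<le> L * \<bar>cosh (M * t) * w t - cosh (M * t) * v t\<bar>"
        unfolding N_def by (rule lip)
      also have "\<dots> = L * cosh (M * t) * \<bar>w t - v t\<bar>"
        by (simp add: abs_mult cosh_real_pos abs_of_pos flip: right_diff_distrib)
      also have "\<dots> \<le> L * cosh (M * t) * B"
        using \<open>L > 0\<close> B by (intro mult_left_mono) (auto simp: cosh_real_nonneg)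
      finally show "\<bar>N w t - N v t\<bar> \<le> L * B * cosh (M * t)" by (simp add: mult_ac)
    qed (use M in \<open>simp_all add: DERIV_diff prim(2)[OF Nc] prim(2)[OF pNc] prim(1)[OF Nc] prim(1)[OF pNc] w v\<close>)
    then show ?thesis using M \<open>L > 0\<close> by simp
  qed
  have Tc: "T w \<in> bcontfun" if w: "continuous_on UNIV w" "bounded (range w)" for w
  proof -
    obtain B where B: "\<And>x. \<bar>w x\<bar> \<le> B" using w(2) by (auto simp: bounded_iff)
    \<comment> \<open>Since \<open>F x 0 = 0\<close>, the zero function has zero source, so the
      contraction estimate against it already bounds the integral part of
      \<open>T w\<close>.\<close>
    have N0: "N (\<lambda>_. 0) = (\<lambda>_. 0)" by (auto simp: N_def F0)
    have p0: "prim (\<lambda>_. 0) = (\<lambda>_. 0)"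
    proof
      fix x
      have "\<exists>c. \<forall>x\<in>UNIV. prim (\<lambda>_. 0) x = c"
        by (rule has_field_derivative_zero_constant) (auto intro!: DERIV_subset[OF prim(2)])
      then show "prim (\<lambda>_. 0) x = 0" using prim(1)[of "\<lambda>_. 0"] by auto
    qed
    have "\<bar>T w x\<bar> \<le> \<bar>\<alpha>\<bar> + \<bar>\<beta>\<bar> / M + 1/2 * B" for x
    proof -
      have ch: "cosh (M * x) \<ge> 1" by (rule cosh_real_ge_1)
      have 1: "\<bar>\<alpha>\<bar> \<le> \<bar>\<alpha>\<bar> * cosh (M * x)" using ch mult_left_mono[OF ch, of "\<bar>\<alpha>\<bar>"] by simp
      have "\<bar>x\<bar> \<le> cosh (M * x) / M" using abs_le_cosh[of "M * x"] M(1)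
        by (simp add: field_simps abs_mult)
      then have "\<bar>\<beta>\<bar> * \<bar>x\<bar> \<le> \<bar>\<beta>\<bar> * (cosh (M * x) / M)" by (intro mult_left_mono) auto
      then have 2: "\<bar>\<beta> * x\<bar> \<le> \<bar>\<beta>\<bar> / M * cosh (M * x)" by (simp add: abs_mult)
      have 3: "\<bar>prim (prim (N w)) x\<bar> \<le> 1/2 * B * cosh (M * x)"
        using contr[of w "\<lambda>_. 0" B x] w B by (simp add: N0 p0)
      have "\<bar>\<alpha> + \<beta> * x + prim (prim (N w)) x\<bar> \<le> (\<bar>\<alpha>\<bar> + \<bar>\<beta>\<bar> / M + 1/2 * B) * cosh (M * x)"
        using 1 2 3 by (simp add: ring_distribs)
      then show ?thesis using ch by (simp add: T_def abs_divide divide_le_eq abs_of_pos cosh_real_pos)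
    qed
    then show ?thesis
      unfolding bcontfun_def T_def using ppNc[OF w(1)]
      by (auto intro!: continuous_intros boundedI[of _ "\<bar>\<alpha>\<bar> + \<bar>\<beta>\<bar> / M + 1/2 * B"])
  qed
  define Tb where "Tb w = Bcontfun (T (apply_bcontfun w))" for w
  have Tb: "apply_bcontfun (Tb w) = T (apply_bcontfun w)" for w
    unfolding Tb_def by (intro Bcontfun_inverse Tc) auto
  have "\<exists>!w. Tb w = w"
  proof (rule banach_fix_type)
    show "\<forall>w :: real \<Rightarrow>\<^sub>C real. \<forall>v. dist (Tb w) (Tb v) \<le> 1/2 * dist w v"
    proof (intro allI dist_bound)
      fix w v :: "real \<Rightarrow>\<^sub>C real" and x
      have "\<bar>prim (prim (N w)) x - prim (prim (N v)) x\<bar> \<le> 1/2 * dist w v * cosh (M * x)"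
        by (rule contr) (auto simp: dist_bounded simp flip: dist_real_def)
      then have "\<bar>(prim (prim (N w)) x - prim (prim (N v)) x) / cosh (M * x)\<bar> \<le> 1/2 * dist w v"
        by (simp add: abs_divide divide_le_eq abs_of_pos cosh_real_pos)
      then show "dist (apply_bcontfun (Tb w) x) (apply_bcontfun (Tb v) x) \<le> 1/2 * dist w v"
        by (simp add: Tb T_def dist_real_def diff_divide_distrib add_divide_distrib)
    qed
  qed auto
  then obtain w where w: "Tb w = w" by auto
  define u where "u x = cosh (M * x) * apply_bcontfun w x" for x
  have Nw: "N w x = F x (u x)" for x by (simp add: N_def u_def)
  have u: "u x = \<alpha> + \<beta> * x + prim (prim (N w)) x" for x
    using arg_cong[OF w, of "\<lambda>w. apply_bcontfun w x"] cosh_real_pos[of "M * x"]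
    by (simp add: Tb T_def u_def field_simps)
  have cw: "continuous_on UNIV (apply_bcontfun w)" by auto
  have "(u has_real_derivative \<beta> + prim (N w) x) (at x)" for x
    unfolding u[abs_def] by (auto intro!: derivative_eq_intros prim(2) pNc cw)
  moreover have "((\<lambda>x. \<beta> + prim (N w) x) has_real_derivative F x (u x)) (at x)" for x
    unfolding Nw[symmetric] by (auto intro!: derivative_eq_intros prim(2) Nc cw)
  moreover have "u 0 = \<alpha>" "\<beta> + prim (N w) 0 = \<beta>"
    by (simp_all add: u prim(1)[OF pNc[OF cw]] prim(1)[OF Nc[OF cw]])
  ultimately show ?thesis
    by (intro exI[of _ u] exI[of _ "\<lambda>x. \<beta> + prim (N (apply_bcontfun w)) x"]) blast
qed

text \<open>The squared phase-space norm changes at a rate of at most \<open>1 + L\<close> times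
  itself, and an integrating factor works in either direction of time. Uniqueness, continuous
  dependence on the data and the persistence of smallness all come from this estimate.\<close>

lemma second_order_gronwall:
  fixes z :: "real \<Rightarrow> real"
  assumes z: "\<And>x. (z has_real_derivative z' x) (at x)" "\<And>x. (z' has_real_derivative z'' x) (at x)"
    and bd: "\<And>x. \<bar>z'' x\<bar> \<le> L * \<bar>z x\<bar>" and "L \<ge> 0"
  shows "(z x)\<^sup>2 + (z' x)\<^sup>2 \<le> ((z c)\<^sup>2 + (z' c)\<^sup>2) * exp ((1 + L) * \<bar>x - c\<bar>)"
proof -
  define N where "N x = (z x)\<^sup>2 + (z' x)\<^sup>2" for x
  define N' where "N' x = 2 * z x * z' x + 2 * z' x * z'' x" for x
  have N: "(N has_real_derivative N' x) (at x)" for x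
    unfolding N_def[abs_def] N'_def by (auto intro!: derivative_eq_intros z)
  have N': "\<bar>N' x\<bar> \<le> (1 + L) * N x" for x
  proof -
    have "\<bar>N' x\<bar> \<le> 2 * \<bar>z x\<bar> * \<bar>z' x\<bar> + 2 * \<bar>z' x\<bar> * \<bar>z'' x\<bar>"
      unfolding N'_def by (rule order_trans[OF abs_triangle_ineq]) (simp add: abs_mult)
    also have "\<dots> \<le> 2 * \<bar>z x\<bar> * \<bar>z' x\<bar> + 2 * \<bar>z' x\<bar> * (L * \<bar>z x\<bar>)"
      by (intro add_left_mono mult_left_mono bd) auto
    also have "\<dots> = (1 + L) * (2 * \<bar>z x\<bar> * \<bar>z' x\<bar>)" by (simp add: algebra_simps)
    also have "\<dots> \<le> (1 + L) * N x"
      using sum_squares_bound[of "\<bar>z x\<bar>" "\<bar>z' x\<bar>"] \<open>L \<ge> 0\<close> unfolding N_def by (intro mult_left_mono) auto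
    finally show ?thesis .
  qed
  have "N x \<le> N c * exp ((1 + L) * \<bar>x - c\<bar>)"
  proof (cases "c \<le> x")
    case True
    have "N x * exp (- (1 + L) * x) \<le> N c * exp (- (1 + L) * c)"
    proof (rule DERIV_nonpos_imp_nonincreasing[OF True])
      fix t
      have "((\<lambda>t. N t * exp (- (1 + L) * t)) has_real_derivative (N' t - (1 + L) * N t) * exp (- (1 + L) * t)) (at t)"
        by (auto intro!: derivative_eq_intros N simp: algebra_simps)
      moreover have "(N' t - (1 + L) * N t) * exp (- (1 + L) * t) \<le> 0"
        using N'[of t] by (intro mult_nonpos_nonneg) auto
      ultimately show "\<exists>y. ((\<lambda>t. N t * exp (- (1 + L) * t)) has_real_derivative y) (at t) \<and> y \<le> 0" by blast
    qed
    then have "N x * exp (- (1 + L) * x) * exp ((1 + L) * x) \<le> N c * exp (- (1 + L) * c) * exp ((1 + L) * x)"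
      by (intro mult_right_mono) auto
    then show ?thesis using True by (simp add: mult.assoc algebra_simps flip: exp_add)
  next
    case False
    then have "x \<le> c" by simp
    have "N x * exp ((1 + L) * x) \<le> N c * exp ((1 + L) * c)"
    proof (rule DERIV_nonneg_imp_nondecreasing[OF \<open>x \<le> c\<close>])
      fix t
      have "((\<lambda>t. N t * exp ((1 + L) * t)) has_real_derivative (N' t + (1 + L) * N t) * exp ((1 + L) * t)) (at t)"
        by (auto intro!: derivative_eq_intros N simp: algebra_simps)
      moreover have "(N' t + (1 + L) * N t) * exp ((1 + L) * t) \<ge> 0"
        using N'[of t] by (intro mult_nonneg_nonneg) auto
      ultimately show "\<exists>y. ((\<lambda>t. N t * exp ((1 + L) * t)) has_real_derivative y) (at t) \<and> 0 \<le> y" by blast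
    qed
    then have "N x * exp ((1 + L) * x) * exp (- (1 + L) * x) \<le> N c * exp ((1 + L) * c) * exp (- (1 + L) * x)"
      by (intro mult_right_mono) auto
    then show ?thesis using False by (simp add: mult.assoc algebra_simps flip: exp_add)
  qed
  then show ?thesis by (simp add: N_def)
qed


section \<open>Energies\<close>

text \<open>The truncated problem stated without \<open>f\<close>, in a form invariant under x ->
  -x, so that results for one half-line transfer to the other. Potentials range over
  \<open>[v\<^sub>0, v\<^sub>1]\<close>. Up to height \<open>s\<^sub>0\<close> the primitive is
  affine in the potential with slope governed by \<open>a\<close>, and \<open>\<mu>\<close> is a
  growth rate there. \<open>Phi_nonpos_imp\<close> carries the monotonicity of f(s)/s, and
  \<open>g_ge_K\<close> expresses the truncation.\<close>

locale scalar_problem =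
  fixes g \<Phi> :: "real \<Rightarrow> real \<Rightarrow> real" and V :: "real \<Rightarrow> real" and v\<^sub>0 v\<^sub>1 L K s\<^sub>0 a \<mu> B :: real
  assumes L_pos: "L > 0"
    and g_lipschitz: "\<And>v s t. v\<^sub>0 \<le> v \<Longrightarrow> v \<le> v\<^sub>1 \<Longrightarrow> \<bar>g v s - g v t\<bar> \<le> L * \<bar>s - t\<bar>"
    and g_lipschitz_potential: "\<And>v v' s. \<bar>g v s - g v' s\<bar> \<le> L * \<bar>v - v'\<bar>"
    and g_nonpos: "\<And>v s. s \<le> 0 \<Longrightarrow> g v s = 0"
    and g_mono: "\<And>v v' s. v \<le> v' \<Longrightarrow> g v s \<le> g v' s"
    and Phi_0: "\<And>v. \<Phi> v 0 = 0"
    and Phi_deriv: "\<And>v s. v\<^sub>0 \<le> v \<Longrightarrow> v \<le> v\<^sub>1 \<Longrightarrow> (\<Phi> v has_real_derivative g v s) (at s)"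
    and Phi_small_diff: "\<And>v v' s. v\<^sub>0 \<le> v \<Longrightarrow> v \<le> v\<^sub>1 \<Longrightarrow> v\<^sub>0 \<le> v' \<Longrightarrow> v' \<le> v\<^sub>1 \<Longrightarrow> 0 \<le> s \<Longrightarrow> s \<le> s\<^sub>0 \<Longrightarrow>
          \<Phi> v s - \<Phi> v' s = a * (v - v') * s\<^sup>2 / 2"
    and Phi_small_ge: "\<And>v s. v\<^sub>0 \<le> v \<Longrightarrow> v \<le> v\<^sub>1 \<Longrightarrow> 0 \<le> s \<Longrightarrow> s \<le> s\<^sub>0 \<Longrightarrow> \<mu>\<^sup>2 * s\<^sup>2 / 2 \<le> \<Phi> v s"
    and Phi_nonpos_imp: "\<And>v s. v\<^sub>0 \<le> v \<Longrightarrow> v \<le> v\<^sub>1 \<Longrightarrow> 0 < s \<Longrightarrow> \<Phi> v s \<le> 0 \<Longrightarrow> g v s < 0"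
    and a_pos: "a > 0" and mu_pos: "\<mu> > 0" and s0_pos: "s\<^sub>0 > 0"
    and K_pos: "K > 0" and Phi_K: "\<Phi> v\<^sub>1 K = 0" and Phi_pos: "\<And>s. 0 < s \<Longrightarrow> s < K \<Longrightarrow> 0 < \<Phi> v\<^sub>1 s"
    and g_ge_K: "\<And>s. K \<le> s \<Longrightarrow> g v\<^sub>1 s = g v\<^sub>1 K"
    and V_bounds: "\<And>x. v\<^sub>0 \<le> V x" "\<And>x. V x \<le> v\<^sub>1"
    and V_lipschitz: "\<And>x y. \<bar>V x - V y\<bar> \<le> B * \<bar>x - y\<bar>"
    and V_antimono: "\<And>x y. x \<le> y \<Longrightarrow> y \<le> 0 \<Longrightarrow> V y \<le> V x"
    and V_mono: "\<And>x y. 0 \<le> x \<Longrightarrow> x \<le> y \<Longrightarrow> V x \<le> V y"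
    and V_lim_top: "(V \<longlongrightarrow> v\<^sub>1) at_top" and V_lim_bot: "(V \<longlongrightarrow> v\<^sub>1) at_bot"
begin

lemma v1_bounds: "v\<^sub>0 \<le> v\<^sub>1" "v\<^sub>1 \<le> v\<^sub>1"
  using V_bounds[of 0] by auto

lemma reflected: "scalar_problem g \<Phi> (\<lambda>x. V (- x)) v\<^sub>0 v\<^sub>1 L K s\<^sub>0 a \<mu> B"
proof
  show "\<bar>V (- x) - V (- y)\<bar> \<le> B * \<bar>x - y\<bar>" for x y
    using V_lipschitz[of "- x" "- y"] by (simp add: abs_minus_commute)
  show "((\<lambda>x. V (- x)) \<longlongrightarrow> v\<^sub>1) at_top" "((\<lambda>x. V (- x)) \<longlongrightarrow> v\<^sub>1) at_bot"
    using filterlim_compose[OF V_lim_bot filterlim_uminus_at_bot_at_top]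
      filterlim_compose[OF V_lim_top filterlim_uminus_at_top_at_bot] by auto
  show "V (- y) \<le> V (- x)" if "x \<le> y" "y \<le> 0" for x y using V_mono[of "- y" "- x"] that by simp
  show "V (- x) \<le> V (- y)" if "0 \<le> x" "x \<le> y" for x y using V_antimono[of "- y" "- x"] that by simp
qed (fact L_pos g_lipschitz g_lipschitz_potential g_nonpos g_mono Phi_0 Phi_deriv Phi_small_diff
    Phi_small_ge Phi_nonpos_imp a_pos mu_pos s0_pos K_pos Phi_K Phi_pos g_ge_K V_bounds)+

section \<open>Initial value problems: existence, dependence on data, uniqueness\<close>

definition sol :: "(real \<Rightarrow> real) \<Rightarrow> (real \<Rightarrow> real) \<Rightarrow> bool" where
  "sol u w \<longleftrightarrow> (\<forall>x. (u has_real_derivative w x) (at x) \<and> (w has_real_derivative g (V x) (u x)) (at x))"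

lemma solD:
  assumes "sol u w"
  shows "(u has_real_derivative w x) (at x)" "(w has_real_derivative g (V x) (u x)) (at x)"
  using assms by (auto simp: sol_def)

lemma sol_continuous:
  assumes "sol u w"
  shows "continuous_on S u" "continuous_on S w"
  by (meson DERIV_continuous_on DERIV_subset solD[OF assms] subset_UNIV)+

lemma V_continuous: "continuous_on UNIV V"
proof -
  have "\<bar>B\<bar>-lipschitz_on UNIV V"
  proof (rule lipschitz_onI)
    show "dist (V x) (V y) \<le> \<bar>B\<bar> * dist x y" for x y
      using V_lipschitz[of x y] mult_right_mono[OF abs_ge_self[of B], of "\<bar>x - y\<bar>"]
      by (simp add: dist_real_def)
  qed simp
  then show ?thesis by (rule lipschitz_on_continuous_on)
qed

lemma rhs_continuous:
  fixes u h :: "real \<Rightarrow> real"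
  assumes "continuous_on UNIV u" "continuous_on UNIV h"
  shows "continuous_on UNIV (\<lambda>x. g (V (h x)) (u x))"
proof -
  have Vh: "isCont (\<lambda>x. V (h x)) x" for x
    using continuous_on_compose2[OF V_continuous assms(2)] by (simp add: continuous_on_eq_continuous_at)
  have u: "isCont u x" for x using assms(1) by (simp add: continuous_on_eq_continuous_at)
  have "((\<lambda>y. g (V (h y)) (u y)) \<longlongrightarrow> g (V (h x)) (u x)) (at x)" for x
  proof (rule LIM_zero_cancel, rule Lim_null_comparison)
    show "eventually (\<lambda>y. norm (g (V (h y)) (u y) - g (V (h x)) (u x))
        \<le> L * \<bar>V (h y) - V (h x)\<bar> + L * \<bar>u y - u x\<bar>) (at x)"
    proof (intro always_eventually allI)
      fix y
      show "norm (g (V (h y)) (u y) - g (V (h x)) (u x)) \<le> L * \<bar>V (h y) - V (h x)\<bar> + L * \<bar>u y - u x\<bar>"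
        using g_lipschitz_potential[of "V (h y)" "u y" "V (h x)"] g_lipschitz[OF V_bounds, of "h x" "u y" "u x"]
        unfolding real_norm_def by linarith
    qed
    show "((\<lambda>y. L * \<bar>V (h y) - V (h x)\<bar> + L * \<bar>u y - u x\<bar>) \<longlongrightarrow> 0) (at x)"
      using Vh[of x] u[of x] unfolding isCont_def by (auto intro!: tendsto_eq_intros)
  qed
  then show ?thesis by (simp add: continuous_on_eq_continuous_at isCont_def)
qed

lemma sol_exists: "\<exists>u w. sol u w \<and> u c = \<alpha> \<and> w c = \<beta>"
proof -
  have "\<exists>u w. u 0 = \<alpha> \<and> w 0 = \<beta> \<and> (\<forall>x. (u has_real_derivative w x) (at x)
    \<and> (w has_real_derivative g (V (x + c)) (u x)) (at x))"
  proof (rule second_order_ode_exists[where L = L])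
    show "continuous_on UNIV (\<lambda>x. g (V (x + c)) (u x))" if "continuous_on UNIV u" for u
      using that by (intro rhs_continuous continuous_intros)
  qed (simp_all add: g_lipschitz V_bounds g_nonpos L_pos)
  then obtain u w where uw: "u 0 = \<alpha>" "w 0 = \<beta>" "\<And>x. (u has_real_derivative w x) (at x)"
    "\<And>x. (w has_real_derivative g (V (x + c)) (u x)) (at x)" by blast
  have "sol (\<lambda>x. u (x - c)) (\<lambda>x. w (x - c))"
    unfolding sol_def using uw(3)[of "_ - c"] uw(4)[of "_ - c"]
    by (simp add: DERIV_at_within_shift[where z = "- c", simplified] DERIV_shift[where z = "- c", simplified])
  then show ?thesis using uw(1,2) by (intro exI[of _ "\<lambda>x. u (x - c)"] exI[of _ "\<lambda>x. w (x - c)"]) auto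
qed

lemma sol_dependence:
  assumes "sol u w" "sol y z"
  shows "(u x - y x)\<^sup>2 + (w x - z x)\<^sup>2 \<le> ((u c - y c)\<^sup>2 + (w c - z c)\<^sup>2) * exp ((1 + L) * \<bar>x - c\<bar>)"
  by (rule second_order_gronwall[where z = "\<lambda>x. u x - y x" and z' = "\<lambda>x. w x - z x"
        and z'' = "\<lambda>x. g (V x) (u x) - g (V x) (y x)"])
    (use L_pos in \<open>auto intro!: DERIV_diff solD[OF assms(1)] solD[OF assms(2)] g_lipschitz V_bounds\<close>)

lemma sol_unique:
  assumes "sol u w" "sol y z" "u c = y c" "w c = z c"
  shows "u x = y x" "w x = z x"
  using sol_dependence[OF assms(1,2), of x c] assms(3,4) by (simp_all add: sum_power2_le_zero_iff)

text \<open>Nonpositive constants are solutions because \<open>g\<close> vanishes there, and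
  uniqueness does the rest. This plays the part of the strong maximum principle: a solution that is
  positive somewhere has nonzero slope wherever it is nonpositive.\<close>

lemma sol_constant:
  assumes "sol u w" "u c \<le> 0" "w c = 0"
  shows "u x = u c"
proof -
  have "sol (\<lambda>_. u c) (\<lambda>_. 0)" using assms(2) by (auto simp: sol_def g_nonpos)
  from sol_unique(1)[OF assms(1) this, of c] assms(3) show ?thesis by simp
qed

lemma sol_reflect:
  assumes "sol u w"
  shows "scalar_problem.sol g (\<lambda>x. V (- x)) (\<lambda>x. u (- x)) (\<lambda>x. - w (- x))"
proof -
  interpret R: scalar_problem g \<Phi> "\<lambda>x. V (- x)" v\<^sub>0 v\<^sub>1 L K s\<^sub>0 a \<mu> B by (rule reflected)
  show ?thesis unfolding R.sol_def
  proof (intro allI conjI)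
    fix x
    show "((\<lambda>x. u (- x)) has_real_derivative - w (- x)) (at x)"
      using solD(1)[OF assms, of "- x"] by (simp only: DERIV_mirror)
    show "((\<lambda>x. - w (- x)) has_real_derivative g (V (- x)) (u (- x))) (at x)"
      using DERIV_minus[OF solD(2)[OF assms, of "- x", unfolded DERIV_mirror]] by simp
  qed
qed

text \<open>The potential \<open>v\<close> is an independent parameter: for frozen \<open>v\<close>
  the energy is differentiable even where \<open>V\<close> is not. The two energies of the argument
  are \<open>v = v\<^sub>1\<close> and \<open>v = V x\<close>.\<close>

definition E :: "real \<Rightarrow> (real \<Rightarrow> real) \<Rightarrow> (real \<Rightarrow> real) \<Rightarrow> real \<Rightarrow> real" where
  "E v u w x = (w x)\<^sup>2 / 2 - \<Phi> v (u x)"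

lemma E_deriv:
  assumes "sol u w" "v\<^sub>0 \<le> v" "v \<le> v\<^sub>1"
  shows "(E v u w has_real_derivative w x * (g (V x) (u x) - g v (u x))) (at x)"
  unfolding E_def[abs_def]
  by (auto intro!: derivative_eq_intros solD[OF assms(1)] DERIV_chain2[OF Phi_deriv] assms simp: algebra_simps)

lemma E_antimono:
  assumes "sol u w" "v\<^sub>0 \<le> v" "v \<le> v\<^sub>1" "x \<le> y"
    and "\<And>t. x \<le> t \<Longrightarrow> t \<le> y \<Longrightarrow> 0 \<le> w t \<and> V t \<le> v"
  shows "E v u w y \<le> E v u w x"
proof (rule DERIV_nonpos_imp_nonincreasing[OF \<open>x \<le> y\<close>])
  fix t assume "x \<le> t" "t \<le> y"
  with assms(5)[of t] g_mono[of "V t" v "u t"] have "w t * (g (V t) (u t) - g v (u t)) \<le> 0"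
    by (intro mult_nonneg_nonpos) auto
  then show "\<exists>d. (E v u w has_real_derivative d) (at t) \<and> d \<le> 0" using E_deriv[OF assms(1-3)] by blast
qed

lemma E_mono:
  assumes "sol u w" "v\<^sub>0 \<le> v" "v \<le> v\<^sub>1" "x \<le> y"
    and "\<And>t. x \<le> t \<Longrightarrow> t \<le> y \<Longrightarrow> w t \<le> 0 \<and> V t \<le> v"
  shows "E v u w x \<le> E v u w y"
proof (rule DERIV_nonneg_imp_nondecreasing[OF \<open>x \<le> y\<close>])
  fix t assume "x \<le> t" "t \<le> y"
  with assms(5)[of t] g_mono[of "V t" v "u t"] have "0 \<le> w t * (g (V t) (u t) - g v (u t))"
    by (intro mult_nonpos_nonpos) auto
  then show "\<exists>d. (E v u w has_real_derivative d) (at t) \<and> 0 \<le> d" using E_deriv[OF assms(1-3)] by blast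
qed

section \<open>The primitive as a function of height and potential\<close>

lemma Phi_nonpos:
  assumes "s \<le> 0" "v\<^sub>0 \<le> v" "v \<le> v\<^sub>1"
  shows "\<Phi> v s = 0"
proof -
  have "\<Phi> v s \<le> \<Phi> v 0"
    by (rule DERIV_nonneg_imp_nondecreasing[OF assms(1)]) (use Phi_deriv[OF assms(2,3)] g_nonpos in force)
  moreover have "\<Phi> v s \<ge> \<Phi> v 0"
    by (rule DERIV_nonpos_imp_nonincreasing[OF assms(1)]) (use Phi_deriv[OF assms(2,3)] g_nonpos in force)
  ultimately show ?thesis by (simp add: Phi_0)
qed

lemma Phi_mono:
  assumes "v\<^sub>0 \<le> v" "v \<le> v'" "v' \<le> v\<^sub>1"
  shows "\<Phi> v s \<le> \<Phi> v' s"
proof (cases "s \<le> 0")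
  case True
  with assms show ?thesis by (simp add: Phi_nonpos)
next
  case False
  show ?thesis
    by (rule DERIV_mono_le[of 0 s "\<Phi> v" "\<Phi> v'" "g v" "g v'"])
      (use False assms in \<open>auto simp: Phi_0 intro!: Phi_deriv g_mono\<close>)
qed

text \<open>Bounds the gap between the two energies, so that for bounded \<open>u\<close> it closes
  as \<open>V\<close> approaches \<open>v\<^sub>1\<close>.\<close>

lemma Phi_potential_diff:
  assumes "v\<^sub>0 \<le> v" "v \<le> v\<^sub>1" "0 \<le> s"
  shows "\<Phi> v\<^sub>1 s - \<Phi> v s \<le> L * (v\<^sub>1 - v) * s"
proof -
  have "\<Phi> v\<^sub>1 s \<le> \<Phi> v s + L * (v\<^sub>1 - v) * s"
  proof (rule DERIV_mono_le[where F = "\<Phi> v\<^sub>1" and G = "\<lambda>s. \<Phi> v s + L * (v\<^sub>1 - v) * s"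
        and F' = "g v\<^sub>1" and G' = "\<lambda>s. g v s + L * (v\<^sub>1 - v)"])
    show "g v\<^sub>1 t \<le> g v t + L * (v\<^sub>1 - v)" for t
      using g_lipschitz_potential[of v\<^sub>1 t v] assms by (simp add: abs_le_iff)
    show "((\<lambda>s. \<Phi> v s + L * (v\<^sub>1 - v) * s) has_real_derivative g v t + L * (v\<^sub>1 - v)) (at t)" for t
      using assms by (auto intro!: derivative_eq_intros Phi_deriv)
  qed (use assms v1_bounds Phi_deriv in \<open>auto simp: Phi_0\<close>)
  then show ?thesis by simp
qed

lemma g_K_neg: "g v\<^sub>1 K < 0"
  using Phi_nonpos_imp[OF v1_bounds K_pos] Phi_K by simp

text \<open>Beyond \<open>K\<close> the truncated force is the negative constant
  \<open>g v\<^sub>1 K\<close>, so the primitive never returns to zero.\<close>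

lemma Phi_neg:
  assumes "K < s"
  shows "\<Phi> v\<^sub>1 s < 0"
proof -
  have "\<Phi> v\<^sub>1 s < \<Phi> v\<^sub>1 K"
    by (rule DERIV_neg_imp_decreasing[OF assms]) (use Phi_deriv[OF v1_bounds] g_ge_K g_K_neg in metis)
  then show ?thesis by (simp add: Phi_K)
qed

lemma Phi_ge_0_iff: "0 < s \<Longrightarrow> 0 \<le> \<Phi> v\<^sub>1 s \<longleftrightarrow> s \<le> K"
  using Phi_pos[of s] Phi_neg[of s] Phi_K linorder_less_linear[of s K] by auto

abbreviation En :: "(real \<Rightarrow> real) \<Rightarrow> (real \<Rightarrow> real) \<Rightarrow> real \<Rightarrow> real" where
  "En u w x \<equiv> E (V x) u w x"

lemma E_le_En: "E v\<^sub>1 u w x \<le> En u w x"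
  using Phi_mono[OF V_bounds v1_bounds(2), of x "u x"] by (simp add: E_def)

lemma En_antimono:
  assumes "sol u w" "0 \<le> x" "x \<le> y"
  shows "En u w y \<le> En u w x"
proof -
  have "compact (w ` {x..y})" by (intro compact_continuous_image sol_continuous[OF assms(1)]) auto
  then obtain m where m: "\<And>t. x \<le> t \<Longrightarrow> t \<le> y \<Longrightarrow> \<bar>w t\<bar> \<le> m"
    using compact_imp_bounded[of "w ` {x..y}"] by (simp add: bounded_iff) (meson atLeastAtMost_iff)
  have "B \<ge> 0" using V_lipschitz[of 0 1] by (simp add: order_trans[OF abs_ge_zero])
  show ?thesis
  proof (rule nonincreasing_if_quadratic_increments[OF \<open>x \<le> y\<close>, where C = "m * L * B"])
    fix s t assume st: "x \<le> s" "s \<le> t" "t \<le> y"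
    have "E (V t) u w t - E (V t) u w s \<le> m * L * B * (t - s)\<^sup>2"
    proof (cases "s = t")
      case False
      with st have "s < t" by simp
      from MVT2[OF this E_deriv[OF assms(1) V_bounds]] obtain \<xi> where \<xi>: "s < \<xi>" "\<xi> < t"
        "E (V t) u w t - E (V t) u w s = (t - s) * (w \<xi> * (g (V \<xi>) (u \<xi>) - g (V t) (u \<xi>)))" by blast
      have "w \<xi> * (g (V \<xi>) (u \<xi>) - g (V t) (u \<xi>)) \<le> \<bar>w \<xi>\<bar> * \<bar>g (V \<xi>) (u \<xi>) - g (V t) (u \<xi>)\<bar>"
        by (metis abs_ge_self abs_mult)
      also have "\<dots> \<le> m * (L * (B * (t - s)))"
      proof (intro mult_mono)
        show "\<bar>w \<xi>\<bar> \<le> m" using m \<xi> st by simp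
        have "\<bar>g (V \<xi>) (u \<xi>) - g (V t) (u \<xi>)\<bar> \<le> L * \<bar>V \<xi> - V t\<bar>" by (rule g_lipschitz_potential)
        also have "\<dots> \<le> L * (B * \<bar>\<xi> - t\<bar>)" using V_lipschitz L_pos by (intro mult_left_mono) auto
        also have "\<dots> \<le> L * (B * (t - s))" using \<xi> L_pos \<open>B \<ge> 0\<close> by (intro mult_left_mono) auto
        finally show "\<bar>g (V \<xi>) (u \<xi>) - g (V t) (u \<xi>)\<bar> \<le> L * (B * (t - s))" .
      qed (use m[of \<xi>] \<xi> st in auto)
      finally show ?thesis using \<xi> \<open>s < t\<close>
        mult_left_mono[of "w \<xi> * (g (V \<xi>) (u \<xi>) - g (V t) (u \<xi>))" "m * (L * (B * (t - s)))" "t - s"]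
        by (simp add: power2_eq_square mult_ac)
    qed simp
    moreover have "E (V t) u w s \<le> E (V s) u w s"
      using Phi_mono[OF V_bounds(1) V_mono V_bounds(2)] st assms(2) by (simp add: E_def)
    ultimately show "En u w t - En u w s \<le> m * L * B * (t - s)\<^sup>2" by simp
  qed
qed

lemma En_mono:
  assumes "sol u w" "x \<le> y" "y \<le> 0"
  shows "En u w x \<le> En u w y"
proof -
  interpret R: scalar_problem g \<Phi> "\<lambda>x. V (- x)" v\<^sub>0 v\<^sub>1 L K s\<^sub>0 a \<mu> B by (rule reflected)
  show ?thesis using R.En_antimono[OF sol_reflect[OF assms(1)], of "- y" "- x"] assms(2,3)
    by (simp add: R.E_def E_def)
qed

end


context scalar_problem
begin

lemma Phi_continuous: "v\<^sub>0 \<le> v \<Longrightarrow> v \<le> v\<^sub>1 \<Longrightarrow> continuous_on S (\<Phi> v)"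
  by (meson DERIV_continuous_on DERIV_subset Phi_deriv subset_UNIV)

lemma E_continuous:
  assumes "sol u w" "v\<^sub>0 \<le> v" "v \<le> v\<^sub>1"
  shows "continuous_on S (E v u w)"
  by (meson DERIV_continuous_on DERIV_subset E_deriv[OF assms] subset_UNIV)

lemma sol_mono:
  assumes "sol u w" "x \<le> y" "\<And>t. x \<le> t \<Longrightarrow> t \<le> y \<Longrightarrow> 0 \<le> w t"
  shows "u x \<le> u y"
  by (rule DERIV_nonneg_imp_nondecreasing[OF assms(2)]) (use solD(1)[OF assms(1)] assms(3) in blast)

lemma sol_antimono:
  assumes "sol u w" "x \<le> y" "\<And>t. x \<le> t \<Longrightarrow> t \<le> y \<Longrightarrow> w t \<le> 0"
  shows "u y \<le> u x"
  by (rule DERIV_nonpos_imp_nonincreasing[OF assms(2)]) (use solD(1)[OF assms(1)] assms(3) in blast)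

section \<open>Shooting\<close>

text \<open>Nonnegative energy and the quadratic lower bound on the primitive give w^2 \<ge> (\<mu>
  u)^2, so the slope cannot vanish while \<open>u\<close> is positive and small; the growth is at
  least exponential with rate \<open>\<mu>\<close>.\<close>

lemma growth_while_small:
  assumes s: "sol u w" and small: "\<And>t. \<alpha> \<le> t \<Longrightarrow> t \<le> \<beta> \<Longrightarrow> u t \<le> s\<^sub>0"
    and En: "\<And>t. \<alpha> \<le> t \<Longrightarrow> t \<le> \<beta> \<Longrightarrow> 0 \<le> En u w t"
    and init: "0 < u \<alpha>" "0 < w \<alpha>" and x: "\<alpha> \<le> x" "x \<le> \<beta>"
  shows "0 < w x" "u \<alpha> \<le> u x" "\<mu> * u x \<le> w x"
proof -
  have step: "u \<alpha> \<le> u z \<and> \<mu> * u z \<le> w z" if "\<alpha> \<le> z" "z \<le> \<beta>" "\<And>t. \<alpha> \<le> t \<Longrightarrow> t \<le> z \<Longrightarrow> 0 \<le> w t" for z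
  proof -
    have u: "u \<alpha> \<le> u z" using sol_mono[OF s] that by blast
    then have "\<mu>\<^sup>2 * (u z)\<^sup>2 / 2 \<le> \<Phi> (V z) (u z)"
      using init small[of z] that by (intro Phi_small_ge V_bounds) auto
    then have "(\<mu> * u z)\<^sup>2 \<le> (w z)\<^sup>2"
      using En[of z] that by (simp add: E_def power_mult_distrib)
    with u show ?thesis using that(3)[of z] that(1) power2_le_imp_le by blast
  qed
  have pos: "0 < w z" if "\<alpha> \<le> z" "z \<le> \<beta>" for z
  proof -
    have "- w z < 0"
    proof (rule continuous_induct_neg[OF that(1), where w = "\<lambda>z. - w z"])
      show "continuous_on {\<alpha>..z} (\<lambda>z. - w z)" by (intro continuous_intros sol_continuous[OF s])
      fix y assume "\<alpha> \<le> y" "y \<le> z" "\<And>t. \<alpha> \<le> t \<Longrightarrow> t \<le> y \<Longrightarrow> - w t \<le> 0"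
      then have "u \<alpha> \<le> u y \<and> \<mu> * u y \<le> w y" using that by (intro step) auto
      then show "- w y < 0" using init mu_pos mult_pos_pos[of \<mu> "u y"] by linarith
    qed (use init in auto)
    then show ?thesis by simp
  qed
  show "0 < w x" by (rule pos[OF x])
  have "u \<alpha> \<le> u x \<and> \<mu> * u x \<le> w x" by (rule step[OF x]) (use pos x in force)
  then show "u \<alpha> \<le> u x" "\<mu> * u x \<le> w x" by auto
qed

text \<open>The well of \<open>V\<close> costs energy: on \<open>[-d, 0]\<close> the solution loses a fixed fraction of
  \<open>u(0)\<^sup>2\<close>, which exceeds the gap between the energies for \<open>V p\<close> and \<open>v\<^sub>1\<close> once \<open>V p\<close> is close
  to \<open>v\<^sub>1\<close>, so that the energy at \<open>p\<close> is negative.\<close>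

lemma energy_drop:
  assumes s: "sol u w" and dp: "0 < d" "0 \<le> p"
    and gap: "v\<^sub>1 - V p < (v\<^sub>1 - V (- d)) * (1 - exp (- 2 * \<mu> * d))"
    and small: "\<And>t. - d \<le> t \<Longrightarrow> t \<le> p \<Longrightarrow> u t \<le> s\<^sub>0"
    and En: "\<And>t. - d \<le> t \<Longrightarrow> t \<le> p \<Longrightarrow> 0 \<le> En u w t"
    and init: "0 < u (- d)" "0 < w (- d)" and E: "E v\<^sub>1 u w (- d) \<le> 0"
  shows False
proof -
  have gr: "0 < w t" "u (- d) \<le> u t" "\<mu> * u t \<le> w t" if "- d \<le> t" "t \<le> p" for t
    using growth_while_small[where \<alpha> = "- d" and \<beta> = p, OF s small En init that] by auto
  have pos: "0 < u t" if "- d \<le> t" "t \<le> p" for t using gr(2)[OF that] init by auto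
  \<comment> \<open>The growth bound \<open>\<mu> * u t \<le> w t\<close> makes
    \<open>u t * exp (- (\<mu> * t))\<close> nondecreasing; squaring yields the exponential factor
    in \<open>gap\<close>.\<close>
  have "u (- d) * exp (- (\<mu> * - d)) \<le> u 0 * exp (- (\<mu> * 0))"
  proof (rule DERIV_nonneg_imp_nondecreasing[of "- d" 0 "\<lambda>t. u t * exp (- (\<mu> * t))"])
    show "- d \<le> 0" using dp by simp
    fix t :: real assume t: "- d \<le> t" "t \<le> 0"
    have "((\<lambda>t. u t * exp (- (\<mu> * t))) has_real_derivative (w t - \<mu> * u t) * exp (- (\<mu> * t))) (at t)"
      by (auto intro!: derivative_eq_intros solD[OF s] simp: algebra_simps)
    moreover have "0 \<le> (w t - \<mu> * u t) * exp (- (\<mu> * t))" using gr(3)[of t] t dp by simp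
    ultimately show "\<exists>y. ((\<lambda>t. u t * exp (- (\<mu> * t))) has_real_derivative y) (at t) \<and> 0 \<le> y" by blast
  qed
  then have "u (- d) * exp (\<mu> * d) \<le> u 0" by simp
  then have "(u (- d) * exp (\<mu> * d))\<^sup>2 \<le> (u 0)\<^sup>2" using init by (intro power_mono) auto
  then have "(u (- d))\<^sup>2 * exp (2 * \<mu> * d) \<le> (u 0)\<^sup>2"
    by (simp add: power_mult_distrib mult_ac flip: exp_double)
  then have "(u (- d))\<^sup>2 * exp (2 * \<mu> * d) * exp (- 2 * \<mu> * d) \<le> (u 0)\<^sup>2 * exp (- 2 * \<mu> * d)"
    by (rule mult_right_mono) simp
  then have ud: "(u (- d))\<^sup>2 \<le> (u 0)\<^sup>2 * exp (- 2 * \<mu> * d)" by (simp add: mult.assoc flip: exp_add)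
  have diff: "\<Phi> v (u t) - \<Phi> v' (u t) = a * (v - v') * (u t)\<^sup>2 / 2"
    if "v\<^sub>0 \<le> v" "v \<le> v\<^sub>1" "v\<^sub>0 \<le> v'" "v' \<le> v\<^sub>1" "- d \<le> t" "t \<le> p" for v v' t
    using that pos[of t] small[of t] by (intro Phi_small_diff) auto
  \<comment> \<open>The potential is frozen at its largest value on each side, \<open>V p\<close> on
    the right and \<open>V (- d)\<close> on the left. A rising solution loses frozen energy on both,
    and the changes of potential at 0 and at \<open>- d\<close> cost exact multiples of u^2.\<close>
  have "0 \<le> En u w p" using En dp by simp
  also have "En u w p \<le> E (V p) u w 0"
    by (rule E_antimono[OF s V_bounds]) (use dp gr(1) V_mono in \<open>auto intro: less_imp_le\<close>)
  also have "\<dots> = E (V (- d)) u w 0 - a * (V p - V (- d)) * (u 0)\<^sup>2 / 2"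
    using diff[OF V_bounds V_bounds, of 0 p "- d"] dp by (simp add: E_def)
  also have "E (V (- d)) u w 0 \<le> E (V (- d)) u w (- d)"
    by (rule E_antimono[OF s V_bounds]) (use dp gr(1) V_antimono in \<open>auto intro: less_imp_le\<close>)
  also have "\<dots> = E v\<^sub>1 u w (- d) + a * (v\<^sub>1 - V (- d)) * (u (- d))\<^sup>2 / 2"
    using diff[OF v1_bounds V_bounds, of "- d" "- d"] dp by (simp add: E_def)
  also have "\<dots> \<le> a * (v\<^sub>1 - V (- d)) * ((u 0)\<^sup>2 * exp (- 2 * \<mu> * d)) / 2"
  proof -
    have "a * (v\<^sub>1 - V (- d)) * (u (- d))\<^sup>2 \<le> a * (v\<^sub>1 - V (- d)) * ((u 0)\<^sup>2 * exp (- 2 * \<mu> * d))"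
      by (rule mult_left_mono[OF ud]) (use a_pos V_bounds[of "- d"] in simp)
    with E show ?thesis by linarith
  qed
  finally have "0 \<le> a * (u 0)\<^sup>2 / 2 * ((v\<^sub>1 - V p) - (v\<^sub>1 - V (- d)) * (1 - exp (- 2 * \<mu> * d)))"
    by (simp add: field_simps)
  moreover have "0 < a * (u 0)\<^sup>2 / 2" using a_pos pos[of 0] dp by simp
  ultimately show False using gap by (simp add: zero_le_mult_iff)
qed

text \<open>A positive limit energy \<open>e\<close> would only grow while \<open>u\<close> falls.
  At heights up to \<open>K\<close> it keeps the speed above \<open>sqrt (2 * e)\<close>, and above
  \<open>K\<close> the negative force steepens the fall, so \<open>u\<close> would reach zero in
  finite time.\<close>

lemma E_nonpos_while_falling:
  assumes s: "sol u w" and pos: "\<And>x. \<alpha> \<le> x \<Longrightarrow> 0 < u x" and y: "\<alpha> \<le> y" "w y < 0"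
  shows "E v\<^sub>1 u w y \<le> 0"
proof (rule ccontr)
  assume neg: "\<not> ?thesis"
  define e where "e = E v\<^sub>1 u w y"
  have "e > 0" using neg by (simp add: e_def)
  \<comment> \<open>The first entry serves at heights above \<open>K\<close>, where \<open>w\<close>
    decreases from \<open>w y\<close>; the second serves below. Proving the bound with
    \<open>m / 2\<close> leaves room for a strict inequality in the induction.\<close>
  define m where "m = min (- w y) (sqrt (2 * e))"
  have m: "m > 0" "w y \<le> - m" "m \<le> sqrt (2 * e)" using y \<open>e > 0\<close> by (auto simp: m_def)
  have fall: "w z + m / 2 < 0" if "y \<le> z" for z
  proof (rule continuous_induct_neg[OF that, where w = "\<lambda>z. w z + m / 2"])
    show "continuous_on {y..z} (\<lambda>z. w z + m / 2)" by (intro continuous_intros sol_continuous[OF s])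
    show "w y + m / 2 < 0" using m by simp
    fix z assume z: "y \<le> z" and "\<And>t. y \<le> t \<Longrightarrow> t \<le> z \<Longrightarrow> w t + m / 2 \<le> 0"
    then have neg: "w t \<le> 0" if "y \<le> t" "t \<le> z" for t using that m(1) by force
    have e: "e \<le> E v\<^sub>1 u w z" unfolding e_def by (rule E_mono[OF s v1_bounds z]) (use neg V_bounds in auto)
    have "w z \<le> - m"
    proof (cases "u z \<le> K")
      case True
      then have "2 * e \<le> (w z)\<^sup>2" using e Phi_ge_0_iff[of "u z"] pos[of z] y z by (simp add: E_def)
      then have "sqrt (2 * e) \<le> \<bar>w z\<bar>" using real_sqrt_le_mono[of "2 * e" "(w z)\<^sup>2"] by simp
      then show ?thesis using m(3) neg[of z] z by simp
    next
      case False
      have "w z \<le> w y"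
      proof (rule DERIV_nonpos_imp_nonincreasing[OF z])
        fix t assume t: "y \<le> t" "t \<le> z"
        have "u z \<le> u t" by (rule sol_antimono[OF s t(2)]) (use neg t in auto)
        then have "g (V t) (u t) \<le> 0"
          using g_mono[OF V_bounds(2), of t "u t"] g_ge_K[of "u t"] g_K_neg False by simp
        then show "\<exists>d. (w has_real_derivative d) (at t) \<and> d \<le> 0" using solD(2)[OF s] by blast
      qed
      then show ?thesis using m(2) by simp
    qed
    then show "w z + m / 2 < 0" using m(1) by simp
  qed
  define z where "z = y + 2 * u y / m"
  have "y \<le> z" using pos[OF y(1)] m(1) by (simp add: z_def)
  have "u z \<le> u y - m / 2 * (z - y)"
  proof (rule DERIV_mono_le[OF \<open>y \<le> z\<close>, where F' = w and G' = "\<lambda>_. - m / 2"])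
    show "((\<lambda>z. u y - m / 2 * (z - y)) has_real_derivative - m / 2) (at t)" for t
      by (auto intro!: derivative_eq_intros)
    show "w t \<le> - m / 2" if "y \<le> t" for t using fall[OF that] by simp
  qed (use solD(1)[OF s] in auto)
  then have "u z \<le> 0" using m(1) by (simp add: z_def)
  then show False using pos[of z] \<open>y \<le> z\<close> y(1) by simp
qed

text \<open>After the last time with nonpositive limit energy, the solution cannot fall, by the
  previous lemma; but while it does not fall, the limit energy does not increase.\<close>

lemma E_nonpos:
  assumes s: "sol u w" and pos: "\<And>x. \<alpha> \<le> x \<Longrightarrow> 0 < u x" and E: "E v\<^sub>1 u w \<alpha> \<le> 0" and x: "\<alpha> \<le> x"
  shows "E v\<^sub>1 u w x \<le> 0"
proof (rule ccontr)
  assume neg: "\<not> ?thesis"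
  let ?E = "E v\<^sub>1 u w"
  let ?S = "{\<alpha>..x} \<inter> ?E -` {..0}"
  have "compact ?S"
    by (rule closedin_compact[OF compact_Icc continuous_closedin_preimage[OF E_continuous[OF s v1_bounds] closed_atMost]])
  moreover have "?S \<noteq> {}" using E x by auto
  ultimately obtain z where z: "z \<in> ?S" "\<And>t. t \<in> ?S \<Longrightarrow> t \<le> z"
    using compact_attains_sup by (metis (no_types, lifting))
  have "?E x \<le> ?E z"
  proof (rule DERIV_nonpos_imp_decreasing_open[where f = ?E])
    show "z \<le> x" using z by simp
    fix t assume t: "z < t" "t < x"
    then have "0 < ?E t" using z(2)[of t] z(1) by force
    then have "0 \<le> w t" using E_nonpos_while_falling[OF s pos, of t] t z(1) by force
    then have "w t * (g (V t) (u t) - g v\<^sub>1 (u t)) \<le> 0"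
      using g_mono[OF V_bounds(2), of t "u t"] by (intro mult_nonneg_nonpos) auto
    then show "\<exists>d. (?E has_real_derivative d) (at t) \<and> d \<le> 0" using E_deriv[OF s v1_bounds] by blast
  qed (rule E_continuous[OF s v1_bounds])
  then show False using z(1) neg by simp
qed

lemma sol_pos_if_nonneg:
  assumes s: "sol u w" and nn: "\<And>x. \<alpha> \<le> x \<Longrightarrow> 0 \<le> u x" and "0 < u \<alpha>" "\<alpha> \<le> x"
  shows "0 < u x"
proof (rule ccontr)
  assume "\<not> 0 < u x"
  then have 0: "u x = 0" "x \<noteq> \<alpha>" using nn[OF \<open>\<alpha> \<le> x\<close>] \<open>0 < u \<alpha>\<close> by auto
  have "w x = 0"
    by (rule DERIV_local_min[OF solD(1)[OF s], of "x - \<alpha>"]) (use 0 \<open>\<alpha> \<le> x\<close> nn in auto)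
  from sol_constant[OF s _ this, of \<alpha>] 0 \<open>0 < u \<alpha>\<close> show False by simp
qed

text \<open>Once the energy is negative on \<open>x \<ge> 0\<close> it stays so and keeps \<open>u\<close> positive; a solution that
  has crossed zero before would need a nonpositive interior minimum, where it is constant.\<close>

lemma En_nonneg_if_crossing:
  assumes s: "sol u w" and "\<alpha> \<le> 0" "0 < u \<alpha>" "0 \<le> En u w \<alpha>" and y: "\<alpha> \<le> y" "u y < 0" and x: "\<alpha> \<le> x"
  shows "0 \<le> En u w x"
proof (rule ccontr)
  assume neg: "\<not> ?thesis"
  \<comment> \<open>On the left half-line the energy can only grow from its nonnegative initial
    value.\<close>
  have "x > 0" using En_mono[OF s x] assms(4) neg by fastforce
  have pos: "0 < u t" if "x \<le> t" for t
  proof (rule ccontr)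
    assume "\<not> 0 < u t"
    then have "0 \<le> En u w t" using Phi_nonpos[OF _ V_bounds, of "u t" t] by (simp add: E_def)
    moreover have "En u w t \<le> En u w x" using En_antimono[OF s _ that] \<open>x > 0\<close> by simp
    ultimately show False using neg by simp
  qed
  then have "y < x" using y(2) by (metis less_asym not_le)
  obtain z where z: "z \<in> {\<alpha>..x}" "\<And>t. t \<in> {\<alpha>..x} \<Longrightarrow> u z \<le> u t"
    using continuous_attains_inf[OF compact_Icc _ sol_continuous(1)[OF s], of \<alpha> x] x by auto
  have uz: "u z < 0" using z(2)[of y] y \<open>y < x\<close> by simp
  then have "\<alpha> < z" "z < x" using z(1) pos[of x] \<open>0 < u \<alpha>\<close> by (auto simp: order_le_less)
  have "w z = 0"
    by (rule DERIV_local_min[OF solD(1)[OF s], of "min (z - \<alpha>) (x - z)"])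
      (use z \<open>\<alpha> < z\<close> \<open>z < x\<close> in \<open>auto simp: abs_if split: if_splits\<close>)
  from sol_constant[OF s _ this, of \<alpha>] uz \<open>0 < u \<alpha>\<close> show False by simp
qed

text \<open>The force at \<open>K\<close> is negative, so the solution starts to fall, and while it
  falls the limit energy does not drop below 0. A turning point would need height at most 0, the
  primitive being positive between 0 and \<open>K\<close>; there the solution would be constant.
  Hence it falls forever.\<close>

lemma En_nonneg_from_K:
  assumes s: "sol u w" and init: "u \<alpha> = K" "w \<alpha> = 0" and x: "\<alpha> \<le> x"
  shows "0 \<le> En u w x"
proof -
  have E0: "E v\<^sub>1 u w \<alpha> = 0" by (simp add: E_def init Phi_K)
  have "g (V \<alpha>) (u \<alpha>) < 0" using g_mono[OF V_bounds(2), of \<alpha> K] g_K_neg init by simp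
  from DERIV_neg_dec_right[OF solD(2)[OF s] this] init
  obtain \<delta> where \<delta>: "\<delta> > 0" "\<And>h. 0 < h \<Longrightarrow> h < \<delta> \<Longrightarrow> w (\<alpha> + h) < 0" by auto
  have near: "w t < 0" if "\<alpha> < t" "t < \<alpha> + \<delta>" for t using \<delta>(2)[of "t - \<alpha>"] that by simp
  have neg: "w z < 0" if "\<alpha> < z" for z
  proof -
    \<comment> \<open>The slope vanishes at \<open>\<alpha>\<close>, so the induction, which needs a
      strict start, begins slightly later.\<close>
    define y where "y = min z (\<alpha> + \<delta> / 2)"
    have y: "\<alpha> < y" "y \<le> z" "y < \<alpha> + \<delta>" using \<delta>(1) that by (auto simp: y_def)
    have wy: "w t \<le> 0" if "\<alpha> \<le> t" "t \<le> y" for t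
      using near[of t] that y init by (cases "t = \<alpha>") auto
    have Ey: "0 \<le> E v\<^sub>1 u w y"
      using E_mono[OF s v1_bounds, of \<alpha> y] wy V_bounds y E0 by simp
    have "u y < u \<alpha>"
    proof (rule DERIV_neg_imp_decreasing_open[OF y(1)])
      show "\<exists>d. (u has_real_derivative d) (at t) \<and> d < 0" if "\<alpha> < t" "t < y" for t
        using solD(1)[OF s] near[of t] that y by (meson less_trans)
    qed (rule sol_continuous[OF s])
    then have uy: "u y < K" by (simp add: init)
    show ?thesis
    proof (rule continuous_induct_neg[OF y(2)])
      show "continuous_on {y..z} w" by (rule sol_continuous[OF s])
      show "w y < 0" using near y by simp
      fix q assume q: "y \<le> q" and le: "\<And>t. y \<le> t \<Longrightarrow> t \<le> q \<Longrightarrow> w t \<le> 0"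
      have "0 \<le> E v\<^sub>1 u w q" using E_mono[OF s v1_bounds q] le V_bounds Ey by fastforce
      moreover have "u q \<le> u y" by (rule sol_antimono[OF s q le])
      ultimately have "w q = 0 \<Longrightarrow> u q \<le> 0"
        using Phi_pos[of "u q"] uy by (fastforce simp: E_def)
      then have "w q \<noteq> 0" using sol_constant[OF s, of q \<alpha>] init K_pos by auto
      then show "w q < 0" using le[of q] q by simp
    qed
  qed
  have "0 \<le> E v\<^sub>1 u w x"
    using E_mono[OF s v1_bounds x] neg init E0 V_bounds by (metis less_imp_le order.refl order_le_less)
  also have "\<dots> \<le> En u w x" by (rule E_le_En)
  finally show ?thesis .
qed

text \<open>The numbers \<open>d\<close> and \<open>p\<close> that describe the well do not depend
  on \<open>R\<close>, so the same well serves every starting point and the half-lines can later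
  exhaust the line.\<close>

lemma shooting:
  assumes dp: "0 < d" "0 \<le> p" "d \<le> R"
    and gap: "v\<^sub>1 - V p < (v\<^sub>1 - V (- d)) * (1 - exp (- 2 * \<mu> * d))"
  shows "\<exists>u w. sol u w \<and> (\<forall>x\<ge>- R. 0 < u x \<and> 0 \<le> En u w x \<and> E v\<^sub>1 u w x \<le> 0)"
proof -
  \<comment> \<open>The slope that makes the limit energy zero: at constant potential
    \<open>v\<^sub>1\<close>, the data lie on the rising branch of the orbit homoclinic to 0, with
    \<open>K\<close> as its turning point.\<close>
  define \<sigma> where "\<sigma> c = sqrt (2 * \<Phi> v\<^sub>1 c)" for c
  have Phi_nn: "0 \<le> \<Phi> v\<^sub>1 c" if "0 \<le> c" "c \<le> K" for c
    using Phi_ge_0_iff[of c] Phi_0 that by (cases "c = 0") auto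
  have \<sigma>2: "(\<sigma> c)\<^sup>2 = 2 * \<Phi> v\<^sub>1 c" if "0 \<le> c" "c \<le> K" for c using Phi_nn[OF that] by (simp add: \<sigma>_def)
  have \<sigma>_cont: "continuous_on {0..K} \<sigma>" unfolding \<sigma>_def[abs_def] by (intro continuous_intros Phi_continuous v1_bounds)
  obtain U W where UW: "\<And>c. sol (U c) (W c)" "\<And>c. U c (- R) = c" "\<And>c. W c (- R) = \<sigma> c"
  proof -
    have "\<forall>c. \<exists>u w. sol u w \<and> u (- R) = c \<and> w (- R) = \<sigma> c" using sol_exists by blast
    then show ?thesis using that by metis
  qed
  have UW_cont: "continuous_on {0..K} (\<lambda>c. U c x) \<and> continuous_on {0..K} (\<lambda>c. W c x)" for x
  proof -
    let ?k = "\<lambda>b c. sqrt (((c - b)\<^sup>2 + (\<sigma> c - \<sigma> b)\<^sup>2) * exp ((1 + L) * \<bar>x - - R\<bar>))"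
    have bd: "\<bar>U c x - U b x\<bar> \<le> ?k b c \<and> \<bar>W c x - W b x\<bar> \<le> ?k b c" for b c
    proof -
      have "(U c x - U b x)\<^sup>2 + (W c x - W b x)\<^sup>2 \<le> ((c - b)\<^sup>2 + (\<sigma> c - \<sigma> b)\<^sup>2) * exp ((1 + L) * \<bar>x - - R\<bar>)"
        using sol_dependence[OF UW(1) UW(1), of c x b "- R"] by (simp add: UW)
      then show ?thesis by (auto intro!: real_le_rsqrt simp: power2_abs intro: order_trans[rotated])
    qed
    have k: "(?k b \<longlongrightarrow> 0) (at b within {0..K})" if "b \<in> {0..K}" for b
    proof -
      have "(\<sigma> \<longlongrightarrow> \<sigma> b) (at b within {0..K})" using \<sigma>_cont that by (simp add: continuous_on_def)
      then show ?thesis by (auto intro!: tendsto_eq_intros)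
    qed
    show ?thesis unfolding continuous_on_def
    proof (intro conjI ballI)
      fix b assume b: "b \<in> {0..K}"
      show "((\<lambda>c. U c x) \<longlongrightarrow> U b x) (at b within {0..K})" "((\<lambda>c. W c x) \<longlongrightarrow> W b x) (at b within {0..K})"
        by (rule LIM_zero_cancel, rule Lim_null_comparison[OF _ k[OF b]], use bd in auto)+
    qed
  qed
  let ?S = "{0<..K}"
  have U_cont: "continuous_on ?S (\<lambda>c. U c x)" for x using UW_cont[of x] by (auto intro: continuous_on_subset)
  have En_cont: "continuous_on ?S (\<lambda>c. En (U c) (W c) x)" for x
  proof -
    have "continuous_on ?S (\<lambda>c. W c x)" using UW_cont[of x] by (auto intro: continuous_on_subset)
    then show ?thesis unfolding E_def
      by (intro continuous_intros continuous_on_compose2[OF Phi_continuous[OF V_bounds] U_cont]) auto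
  qed
  have E_start: "E v\<^sub>1 (U c) (W c) (- R) = 0" if "c \<in> ?S" for c
    using \<sigma>2[of c] that by (simp add: E_def UW)
  have En_start: "0 \<le> En (U c) (W c) (- R)" if "c \<in> ?S" for c
    using E_le_En[of "U c" "W c" "- R"] E_start[OF that] by simp
  define A where "A = (\<Union>x\<in>{- R..}. ?S \<inter> (\<lambda>c. U c x) -` {..<0})"
  define N where "N = (\<Union>x\<in>{- R..}. ?S \<inter> (\<lambda>c. En (U c) (W c) x) -` {..<0})"
  have "openin (top_of_set ?S) A"
    unfolding A_def by (intro openin_Union) (auto intro!: continuous_openin_preimage_gen U_cont)
  moreover have "openin (top_of_set ?S) N"
    unfolding N_def by (intro openin_Union) (auto intro!: continuous_openin_preimage_gen En_cont)
  moreover have "A \<inter> N = {}"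
  proof -
    have "0 \<le> En (U c) (W c) x" if "c \<in> A" "- R \<le> x" for c x
      using that En_nonneg_if_crossing[OF UW(1), of "- R" c _ x] En_start[of c] dp
      by (auto simp: A_def UW)
    then show ?thesis by (force simp: N_def)
  qed
  moreover have "N \<noteq> {}"
  proof -
    \<comment> \<open>The Gronwall factor from \<open>- R\<close> to \<open>p\<close>: it says how
      small \<open>c\<close> must be for the solution to stay below \<open>s\<^sub>0\<close> on that
      whole interval.\<close>
    define k where "k = exp ((1 + L) * (p + R))"
    have "isCont (\<lambda>c. (c\<^sup>2 + 2 * \<Phi> v\<^sub>1 c) * k) 0"
      using Phi_continuous[OF v1_bounds, of UNIV] by (auto intro!: continuous_intros simp: continuous_on_eq_continuous_at)
    then have "((\<lambda>c. (c\<^sup>2 + 2 * \<Phi> v\<^sub>1 c) * k) \<longlongrightarrow> 0) (at_right 0)"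
      by (simp add: isCont_def Phi_0 filterlim_at_split)
    then have "eventually (\<lambda>c. (c\<^sup>2 + 2 * \<Phi> v\<^sub>1 c) * k < s\<^sub>0\<^sup>2) (at_right 0)"
      using s0_pos by (intro order_tendstoD) auto
    moreover have "eventually (\<lambda>c. c \<in> {0<..<K}) (at_right 0)"
      using K_pos by (rule eventually_at_right_real)
    ultimately obtain c where c: "(c\<^sup>2 + 2 * \<Phi> v\<^sub>1 c) * k < s\<^sub>0\<^sup>2" "0 < c" "c < K"
      using eventually_happens[OF eventually_conj] by (metis (no_types, lifting) greaterThanLessThan_iff trivial_limit_at_right_real)
    have "c \<in> N"
    proof (rule ccontr)
      assume "c \<notin> N"
      then have En: "0 \<le> En (U c) (W c) x" if "- R \<le> x" for x
        using that c by (auto simp: N_def not_less)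
      have small: "U c x \<le> s\<^sub>0" if "- R \<le> x" "x \<le> p" for x
      proof -
        have "sol (\<lambda>_. 0) (\<lambda>_. 0)" by (simp add: sol_def g_nonpos)
        from sol_dependence[OF UW(1)[of c] this, of x "- R"]
        have "(U c x)\<^sup>2 + (W c x)\<^sup>2 \<le> (c\<^sup>2 + 2 * \<Phi> v\<^sub>1 c) * exp ((1 + L) * (x + R))"
          using that c by (simp add: UW \<sigma>2)
        also have "\<dots> \<le> (c\<^sup>2 + 2 * \<Phi> v\<^sub>1 c) * k"
          unfolding k_def using that c Phi_nn[of c] L_pos by (intro mult_left_mono) auto
        finally have "(U c x)\<^sup>2 \<le> s\<^sub>0\<^sup>2" using c(1) zero_le_power2[of "W c x"] by linarith
        then show ?thesis by (rule power2_le_imp_le) (use s0_pos in simp)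
      qed
      have w0: "0 < W c (- R)" using c Phi_pos[of c] by (simp add: UW \<sigma>_def)
      have u0: "0 < U c (- R)" using c by (simp add: UW)
      \<comment> \<open>Small amplitude and nonnegative energy force the solution to rise up to
        \<open>p\<close>. The limit energy therefore decreases from its initial value 0, which is
        what the energy loss in the well requires at \<open>- d\<close>.\<close>
      have pos: "0 < W c x \<and> 0 < U c x" if "- R \<le> x" "x \<le> p" for x
        using growth_while_small(1,2)[where \<alpha> = "- R" and \<beta> = p, OF UW(1)[of c] small En u0 w0 that] u0 by auto
      have "E v\<^sub>1 (U c) (W c) (- d) \<le> E v\<^sub>1 (U c) (W c) (- R)"
        by (rule E_antimono[OF UW(1) v1_bounds]) (use pos dp V_bounds in \<open>auto intro: less_imp_le\<close>)
      then have "E v\<^sub>1 (U c) (W c) (- d) \<le> 0" using E_start[of c] c by simp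
      from energy_drop[OF UW(1) dp(1,2) gap small En _ _ this] pos[of "- d"] dp show False by simp
    qed
    then show ?thesis by blast
  qed
  \<comment> \<open>If \<open>A\<close> and \<open>N\<close> covered all heights, \<open>K\<close>
    would lie in \<open>A\<close>, and two disjoint nonempty open sets would split an interval. It
    is not necessary to decide whether height \<open>K\<close> really crosses zero.\<close>
  moreover have "K \<notin> N"
    using En_nonneg_from_K[OF UW(1)[of K], of "- R"] by (force simp: N_def UW \<sigma>_def Phi_K)
  moreover have "connected ?S" by (simp add: convex_connected)
  moreover have "K \<in> ?S" using K_pos by simp
  ultimately have "\<not> ?S \<subseteq> A \<union> N" unfolding connected_openin by blast
  then obtain c where c: "c \<in> ?S" "c \<notin> A" "c \<notin> N" by blast
  have nn: "0 \<le> U c x" "0 \<le> En (U c) (W c) x" if "- R \<le> x" for x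
    using c that by (auto simp: A_def N_def not_less)
  have pos: "0 < U c x" if "- R \<le> x" for x
    by (rule sol_pos_if_nonneg[OF UW(1) nn(1) _ that]) (use c in \<open>auto simp: UW\<close>)
  moreover have "E v\<^sub>1 (U c) (W c) x \<le> 0" if "- R \<le> x" for x
    by (rule E_nonpos[OF UW(1) pos _ that]) (use E_start[OF c(1)] in auto)
  ultimately show ?thesis using UW(1)[of c] nn(2) by blast
qed

end


section \<open>Limits at infinity of monotone functions and of derivatives\<close>

lemma antimono_bounded_tendsto_at_top:
  fixes u :: "real \<Rightarrow> real"
  assumes mono: "\<And>x y. X \<le> x \<Longrightarrow> x \<le> y \<Longrightarrow> u y \<le> u x" and bd: "\<And>x. X \<le> x \<Longrightarrow> b \<le> u x"
  shows "\<exists>l. (u \<longlongrightarrow> l) at_top"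
proof (intro exI order_tendstoI)
  let ?l = "Inf (u ` {X..})"
  have bb: "bdd_below (u ` {X..})" using bd by (auto intro!: bdd_belowI)
  show "eventually (\<lambda>x. y < u x) at_top" if "y < ?l" for y
  proof (rule eventually_mono[OF eventually_ge_at_top[of X]])
    fix x assume "X \<le> x"
    then have "?l \<le> u x" by (intro cInf_lower bb) auto
    with that show "y < u x" by simp
  qed
  fix y assume "?l < y"
  then obtain x where "X \<le> x" "u x < y" using cInf_lessD[of "u ` {X..}" y] by auto
  then show "eventually (\<lambda>x. u x < y) at_top"
    by (intro eventually_mono[OF eventually_ge_at_top[of x]]) (meson mono le_less_trans)
qed

text \<open>Increments over unit steps tend to 0, and by the mean value theorem each of them is a
  value of the derivative. Convergence of the derivative itself is not claimed.\<close>

lemma deriv_not_bounded_away_if_convergent: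
  fixes f :: "real \<Rightarrow> real"
  assumes lim: "(f \<longlongrightarrow> l) at_top" and f: "\<And>x. (f has_real_derivative f' x) (at x)"
    and ev: "eventually (\<lambda>x. \<kappa> \<le> \<bar>f' x\<bar>) at_top" and "\<kappa> > 0"
  shows False
proof -
  have "filterlim (\<lambda>x::real. 1 + x) at_top at_top"
    by (rule filterlim_tendsto_add_at_top[OF tendsto_const filterlim_ident])
  from tendsto_diff[OF filterlim_compose[OF lim this] lim]
  have "((\<lambda>x. f (1 + x) - f x) \<longlongrightarrow> 0) at_top" by simp
  then have "eventually (\<lambda>x. \<bar>f (1 + x) - f x\<bar> < \<kappa>) at_top"
    using \<open>\<kappa> > 0\<close> by (auto dest: tendstoD simp: dist_real_def)
  moreover obtain X where X: "\<And>x. X \<le> x \<Longrightarrow> \<kappa> \<le> \<bar>f' x\<bar>" using ev by (auto simp: eventually_at_top_linorder)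
  ultimately obtain x where x: "X \<le> x" "\<bar>f (1 + x) - f x\<bar> < \<kappa>"
    using eventually_happens[OF eventually_conj[OF eventually_ge_at_top[of X]]] by force
  obtain z where "x < z" "f (1 + x) - f x = f' z"
    using MVT2[of x "1 + x" f f'] f by auto
  then show False using x X[of z] by simp
qed

context scalar_problem
begin

lemma u_le_K:
  assumes "0 < u x" "E v\<^sub>1 u w x \<le> 0"
  shows "u x \<le> K"
  using assms Phi_ge_0_iff[of "u x"] zero_le_power2[of "w x"] by (simp add: E_def)

section \<open>Homoclinic solutions\<close>

text \<open>Where \<open>u\<close> is positive and small, the primitive is positive and nonnegative
  energy forbids a zero slope, so \<open>w\<close> keeps one sign. Either \<open>u\<close> rises
  through the well and loses too much energy, or its reflection does.\<close>

lemma not_small_near_well: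
  assumes s: "sol u w" and dp: "0 < d" "0 \<le> p" "d \<le> D" "p \<le> D"
    and gap: "v\<^sub>1 - V p < (v\<^sub>1 - V (- d)) * (1 - exp (- 2 * \<mu> * d))"
      "v\<^sub>1 - V (- p) < (v\<^sub>1 - V d) * (1 - exp (- 2 * \<mu> * d))"
    and u: "\<And>x. \<bar>x\<bar> \<le> D \<Longrightarrow> 0 < u x \<and> u x \<le> s\<^sub>0 \<and> 0 \<le> En u w x \<and> E v\<^sub>1 u w x \<le> 0"
  shows False
proof -
  have w: "w x \<noteq> 0" if "\<bar>x\<bar> \<le> D" for x
  proof -
    have "0 < \<mu>\<^sup>2 * (u x)\<^sup>2 / 2" using mu_pos u[OF that] by simp
    also have "\<dots> \<le> \<Phi> (V x) (u x)" using u[OF that] by (intro Phi_small_ge V_bounds) auto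
    finally show ?thesis using u[OF that] by (auto simp: E_def)
  qed
  show False
  proof (cases "0 < w (- d)")
    case True
    show False
      by (rule energy_drop[OF s dp(1,2) gap(1) _ _ _ True]) (use u dp in auto)
  next
    case False
    have "w d < 0"
    proof (rule ccontr)
      assume "\<not> w d < 0"
      then obtain x where "- d \<le> x" "x \<le> d" "w x = 0"
        using IVT'[of w "- d" 0 d, OF _ _ _ sol_continuous(2)[OF s]] False dp by auto
      then show False using w[of x] dp by simp
    qed
    interpret R: scalar_problem g \<Phi> "\<lambda>x. V (- x)" v\<^sub>0 v\<^sub>1 L K s\<^sub>0 a \<mu> B by (rule reflected)
    show False
      by (rule R.energy_drop[OF sol_reflect[OF s] dp(1,2)])
        (use gap(2) u[of "- _"] dp \<open>w d < 0\<close> u[of d] in \<open>auto simp: R.E_def E_def\<close>)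
  qed
qed

lemma homoclinic_exists_well:
  assumes "V 0 < v\<^sub>1"
  shows "\<exists>u w. sol u w \<and> (\<forall>x. 0 < u x \<and> 0 \<le> En u w x \<and> E v\<^sub>1 u w x \<le> 0)"
proof -
  have "isCont V 0" using V_continuous by (simp add: continuous_on_eq_continuous_at)
  then have "eventually (\<lambda>x. V x < v\<^sub>1) (at 0)" using assms by (auto simp: isCont_def dest: order_tendstoD)
  then obtain e where e: "e > 0" "\<And>x. x \<noteq> 0 \<Longrightarrow> \<bar>x\<bar> < e \<Longrightarrow> V x < v\<^sub>1"
    by (auto simp: eventually_at dist_real_def)
  define d where "d = e / 2"
  have d: "0 < d" "V d < v\<^sub>1" "V (- d) < v\<^sub>1" using e(1) e(2)[of d] e(2)[of "- d"] by (auto simp: d_def)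
  \<comment> \<open>The factor in the energy loss over a well of half-width \<open>d\<close>. The
    point \<open>p\<close> is then taken so far out that both gap conditions hold, one for each
    direction of travel.\<close>
  define q where "q = 1 - exp (- 2 * \<mu> * d)"
  have "q > 0" using d mu_pos by (simp add: q_def)
  interpret R: scalar_problem g \<Phi> "\<lambda>x. V (- x)" v\<^sub>0 v\<^sub>1 L K s\<^sub>0 a \<mu> B by (rule reflected)
  have "eventually (\<lambda>p. v\<^sub>1 - (v\<^sub>1 - V (- d)) * q < V p) at_top"
    using d \<open>q > 0\<close> by (intro order_tendstoD(1)[OF V_lim_top]) simp
  moreover have "eventually (\<lambda>p. v\<^sub>1 - (v\<^sub>1 - V d) * q < V (- p)) at_top"
    using d \<open>q > 0\<close> by (intro order_tendstoD(1)[OF R.V_lim_top]) simp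
  ultimately have "eventually (\<lambda>p. 0 \<le> p \<and> v\<^sub>1 - (v\<^sub>1 - V (- d)) * q < V p \<and> v\<^sub>1 - (v\<^sub>1 - V d) * q < V (- p)) at_top"
    using eventually_ge_at_top[of "0::real"] by eventually_elim auto
  then obtain p where p: "0 \<le> p" "v\<^sub>1 - V p < (v\<^sub>1 - V (- d)) * q" "v\<^sub>1 - V (- p) < (v\<^sub>1 - V d) * q"
    by (force dest: eventually_happens)
  \<comment> \<open>A fixed window around the well, contained in the half-line of every approximate
    solution; on it the limit is kept from vanishing.\<close>
  define D where "D = max d p"
  have D: "d \<le> D" "p \<le> D" by (auto simp: D_def)
  have "\<exists>u w. sol u w \<and> (\<forall>x\<ge>- (D + real n). 0 < u x \<and> 0 \<le> En u w x \<and> E v\<^sub>1 u w x \<le> 0)" for n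
    using D d p(2) by (intro shooting[OF d(1) p(1)]) (auto simp: q_def)
  then obtain U W where UW: "\<And>n::nat. sol (U n) (W n)"
    "\<And>n x. - (D + real n) \<le> x \<Longrightarrow> 0 < U n x \<and> 0 \<le> En (U n) (W n) x \<and> E v\<^sub>1 (U n) (W n) x \<le> 0"
    by metis
  have "bounded (\<Phi> v\<^sub>1 ` {0..K})"
    by (intro compact_imp_bounded compact_continuous_image Phi_continuous v1_bounds compact_Icc)
  then obtain m where m: "\<And>s. 0 \<le> s \<Longrightarrow> s \<le> K \<Longrightarrow> \<bar>\<Phi> v\<^sub>1 s\<bar> \<le> m"
    unfolding bounded_iff by (metis atLeastAtMost_iff imageI real_norm_def)
  \<comment> \<open>Nonpositive limit energy bounds height and slope at 0 independently of
    \<open>n\<close>. Convergence of these data is enough, since Gronwall spreads it to every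
    \<open>x\<close>.\<close>
  let ?C = "{0..K} \<times> {- sqrt (2 * m)..sqrt (2 * m)}"
  have data: "(U n 0, W n 0) \<in> ?C" for n
  proof -
    have u: "0 < U n 0" "E v\<^sub>1 (U n) (W n) 0 \<le> 0" using UW(2)[of n 0] D d by auto
    have "U n 0 \<le> K" by (rule u_le_K[OF u])
    moreover have "(W n 0)\<^sup>2 \<le> 2 * m" using u m[of "U n 0"] \<open>U n 0 \<le> K\<close> by (simp add: E_def)
    then have "\<bar>W n 0\<bar> \<le> sqrt (2 * m)" using real_sqrt_le_mono by fastforce
    ultimately show ?thesis using u by (auto simp: abs_le_iff)
  qed
  have "seq_compact ?C" by (intro compact_imp_seq_compact compact_Times compact_Icc)
  then obtain l r where r: "strict_mono r" "((\<lambda>n. (U n 0, W n 0)) \<circ> r) \<longlonglongrightarrow> l"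
    using data unfolding seq_compact_def by meson
  have lim0: "(\<lambda>n. U (r n) 0) \<longlonglongrightarrow> fst l" "(\<lambda>n. W (r n) 0) \<longlonglongrightarrow> snd l"
    using tendsto_fst[OF r(2)] tendsto_snd[OF r(2)] by (simp_all add: o_def)
  obtain u w where s: "sol u w" "u 0 = fst l" "w 0 = snd l" using sol_exists by blast
  have lim: "(\<lambda>n. U (r n) x) \<longlonglongrightarrow> u x" "(\<lambda>n. W (r n) x) \<longlonglongrightarrow> w x" for x
  proof -
    let ?k = "\<lambda>n. sqrt (((U (r n) 0 - u 0)\<^sup>2 + (W (r n) 0 - w 0)\<^sup>2) * exp ((1 + L) * \<bar>x - 0\<bar>))"
    have "?k \<longlonglongrightarrow> sqrt (((u 0 - u 0)\<^sup>2 + (w 0 - w 0)\<^sup>2) * exp ((1 + L) * \<bar>x - 0\<bar>))"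
      using lim0 unfolding s(2,3)[symmetric] by (intro tendsto_intros)
    then have k: "?k \<longlonglongrightarrow> 0" by simp
    have bd: "\<bar>U (r n) x - u x\<bar> \<le> ?k n" "\<bar>W (r n) x - w x\<bar> \<le> ?k n" for n
      using sol_dependence[OF UW(1)[of "r n"] s(1), of x 0]
        zero_le_power2[of "U (r n) x - u x"] zero_le_power2[of "W (r n) x - w x"]
      by (intro real_le_rsqrt, unfold power2_abs, linarith)+
    show "(\<lambda>n. U (r n) x) \<longlonglongrightarrow> u x" "(\<lambda>n. W (r n) x) \<longlonglongrightarrow> w x"
      by (rule LIM_zero_cancel, rule Lim_null_comparison[OF _ k], use bd in auto)+
  qed
  have ev: "\<exists>N. \<forall>n\<ge>N. 0 < U (r n) x \<and> 0 \<le> En (U (r n)) (W (r n)) x \<and> E v\<^sub>1 (U (r n)) (W (r n)) x \<le> 0" for x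
  proof -
    obtain N :: nat where N: "- x \<le> real N" using real_arch_simple by blast
    show ?thesis
    proof (intro exI allI impI)
      fix n assume "N \<le> n"
      also have "n \<le> r n" using r(1) by (rule seq_suble)
      finally have "real N \<le> real (r n)" by simp
      then show "0 < U (r n) x \<and> 0 \<le> En (U (r n)) (W (r n)) x \<and> E v\<^sub>1 (U (r n)) (W (r n)) x \<le> 0"
        using N D d by (intro UW(2)) linarith
    qed
  qed
  have limE: "(\<lambda>n. E v (U (r n)) (W (r n)) x) \<longlonglongrightarrow> E v u w x" if "v\<^sub>0 \<le> v" "v \<le> v\<^sub>1" for v x
  proof -
    have "isCont (\<Phi> v) (u x)" using Phi_deriv[OF that] by (rule DERIV_isCont)
    then show ?thesis unfolding E_def by (intro tendsto_intros lim isCont_tendsto_compose[OF _ lim(1)]) auto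
  qed
  have nn: "0 \<le> u x" for x by (rule LIMSEQ_le_const[OF lim(1)]) (use ev[of x] in \<open>blast intro: less_imp_le\<close>)
  have En: "0 \<le> En u w x" for x by (rule LIMSEQ_le_const[OF limE[OF V_bounds]]) (use ev[of x] in blast)
  have Einf: "E v\<^sub>1 u w x \<le> 0" for x by (rule LIMSEQ_le_const2[OF limE[OF v1_bounds]]) (use ev[of x] in blast)
  \<comment> \<open>A nonnegative limit that touches zero is identically zero. Then some approximate
    solution has tiny data at 0 and stays below \<open>s\<^sub>0\<close> on the whole window, which
    the well excludes.\<close>
  have pos: "0 < u x" for x
  proof (rule ccontr)
    assume "\<not> 0 < u x"
    then have ux: "u x = 0" using nn[of x] by simp
    have "w x = 0" by (rule DERIV_local_min[OF solD(1)[OF s(1)], of 1]) (use ux nn in auto)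
    then have "u 0 = 0" using sol_constant[OF s(1), of x] ux by simp
    have "w 0 = 0" by (rule DERIV_local_min[OF solD(1)[OF s(1)], of 1]) (use \<open>u 0 = 0\<close> nn in auto)
    let ?k = "exp ((1 + L) * D)"
    have "(\<lambda>n. ((U (r n) 0)\<^sup>2 + (W (r n) 0)\<^sup>2) * ?k) \<longlonglongrightarrow> ((u 0)\<^sup>2 + (w 0)\<^sup>2) * ?k"
      by (intro tendsto_intros lim)
    then have "eventually (\<lambda>n. ((U (r n) 0)\<^sup>2 + (W (r n) 0)\<^sup>2) * ?k < s\<^sub>0\<^sup>2) sequentially"
      by (rule order_tendstoD) (use \<open>u 0 = 0\<close> \<open>w 0 = 0\<close> s0_pos in simp)
    then obtain n where n: "((U (r n) 0)\<^sup>2 + (W (r n) 0)\<^sup>2) * ?k < s\<^sub>0\<^sup>2" by (auto simp: eventually_sequentially)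
    have small: "U (r n) x \<le> s\<^sub>0" if "\<bar>x\<bar> \<le> D" for x
    proof -
      have "sol (\<lambda>_. 0) (\<lambda>_. 0)" by (simp add: sol_def g_nonpos)
      from sol_dependence[OF UW(1) this, of "r n" x 0]
      have "(U (r n) x)\<^sup>2 + (W (r n) x)\<^sup>2 \<le> ((U (r n) 0)\<^sup>2 + (W (r n) 0)\<^sup>2) * exp ((1 + L) * \<bar>x\<bar>)" by simp
      also have "\<dots> \<le> ((U (r n) 0)\<^sup>2 + (W (r n) 0)\<^sup>2) * ?k"
        using that L_pos by (intro mult_left_mono) auto
      finally have "(U (r n) x)\<^sup>2 \<le> s\<^sub>0\<^sup>2" using n zero_le_power2[of "W (r n) x"] by linarith
      then show ?thesis by (rule power2_le_imp_le) (use s0_pos in simp)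
    qed
    show False
      by (rule not_small_near_well[OF UW(1)[of "r n"] d(1) p(1) D p(2,3)[unfolded q_def]])
        (use UW(2)[of "r n"] small in \<open>auto simp: abs_le_iff\<close>)
  qed
  show ?thesis using s(1) pos En Einf by blast
qed

text \<open>With constant potential the energy is conserved, so the orbit through
  \<open>(K, 0)\<close> has energy zero throughout. At a nonpositive height its slope would vanish,
  and it would be constant.\<close>

lemma homoclinic_exists_constant:
  assumes "\<And>x. V x = v\<^sub>1"
  shows "\<exists>u w. sol u w \<and> (\<forall>x. 0 < u x \<and> 0 \<le> En u w x \<and> E v\<^sub>1 u w x \<le> 0)"
proof -
  obtain u w where s: "sol u w" "u 0 = K" "w 0 = 0" using sol_exists by blast
  have E: "E v\<^sub>1 u w x = 0" for x
  proof -
    have "(E v\<^sub>1 u w has_real_derivative 0) (at t)" for t using E_deriv[OF s(1) v1_bounds, of t] assms by simp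
    then have "E v\<^sub>1 u w x = E v\<^sub>1 u w 0" using DERIV_isconst_all by blast
    then show ?thesis by (simp add: E_def s Phi_K)
  qed
  have "0 < u x" for x
  proof (rule ccontr)
    assume *: "\<not> 0 < u x"
    then have "w x = 0" using E[of x] Phi_nonpos[OF _ v1_bounds, of "u x"] by (simp add: E_def)
    from sol_constant[OF s(1) _ this, of 0] * show False using s K_pos by simp
  qed
  then show ?thesis using s(1) E assms by (intro exI[of _ u] exI[of _ w]) auto
qed

text \<open>Critical points are strict maxima, so once \<open>u\<close> stops rising it falls
  forever, and a limit \<open>l\<close> exists in \<open>[0, K]\<close>. The squared slope tends to
  twice the primitive at \<open>l\<close>, which excludes the open interval because \<open>u\<close>
  converges. At \<open>l = K\<close> the slope tends to 0 while its derivative stays away from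
  0.\<close>

lemma homoclinic_tendsto_0:
  assumes s: "sol u w" and pos: "\<And>x. 0 < u x" and En: "\<And>x. 0 \<le> En u w x" and E: "\<And>x. E v\<^sub>1 u w x \<le> 0"
  shows "(u \<longlongrightarrow> 0) at_top"
proof -
  have leK: "u x \<le> K" for x using u_le_K pos E by blast
  have crit: "g (V x) (u x) < 0" if "w x = 0" for x
    using Phi_nonpos_imp[OF V_bounds pos, of x x] En[of x] that by (simp add: E_def)
  have stays: "w x < 0" if wz: "w z \<le> 0" and "z < x" for z x
  proof -
    obtain y where y: "z \<le> y" "y \<le> x" "w y < 0"
    proof (cases "w z = 0")
      case True
      obtain \<delta> where \<delta>: "\<delta> > 0" "\<And>h. 0 < h \<Longrightarrow> h < \<delta> \<Longrightarrow> w (z + h) < 0"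
        using DERIV_neg_dec_right[OF solD(2)[OF s] crit[OF True]] True by auto
      define h where "h = min (\<delta> / 2) (x - z)"
      have "0 < h" "h < \<delta>" "h \<le> x - z" using \<delta>(1) \<open>z < x\<close> by (auto simp: h_def)
      then show ?thesis using \<delta>(2)[of h] by (intro that[of "z + h"]) auto
    next
      case False
      then show ?thesis using wz \<open>z < x\<close> by (intro that[of z]) auto
    qed
    show ?thesis
    proof (rule continuous_induct_neg[OF y(2) sol_continuous(2)[OF s] y(3)])
      fix q assume q: "y \<le> q" "\<And>t. y \<le> t \<Longrightarrow> t \<le> q \<Longrightarrow> w t \<le> 0"
      have "w q \<noteq> 0"
      proof
        assume 0: "w q = 0"
        then have "y < q" using q(1) y(3) by (cases "y = q") auto
        obtain \<delta> where \<delta>: "\<delta> > 0" "\<And>h. 0 < h \<Longrightarrow> h < \<delta> \<Longrightarrow> 0 < w (q - h)"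
          using DERIV_neg_dec_left[OF solD(2)[OF s] crit[OF 0]] 0 by auto
        define h where "h = min (\<delta> / 2) (q - y)"
        have "0 < h" "h < \<delta>" "h \<le> q - y" using \<delta>(1) \<open>y < q\<close> by (auto simp: h_def)
        then show False using \<delta>(2)[of h] q(2)[of "q - h"] by auto
      qed
      then show "w q < 0" using q(2)[of q] q(1) by simp
    qed
  qed
  have "\<exists>l. (u \<longlongrightarrow> l) at_top"
  proof (cases "\<exists>z. w z \<le> 0")
    case True
    then obtain z where z: "w z \<le> 0" by blast
    then have wn: "w x \<le> 0" if "z \<le> x" for x using stays[OF z, of x] that by (cases "x = z") auto
    show ?thesis
      by (rule antimono_bounded_tendsto_at_top[of z u 0])
        (use sol_antimono[OF s] wn pos in \<open>auto intro: less_imp_le\<close>)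
  next
    case False
    have "\<exists>l. ((\<lambda>x. - u x) \<longlongrightarrow> l) at_top"
      by (rule antimono_bounded_tendsto_at_top[of 0 _ "- K"])
        (use sol_mono[OF s] False leK in \<open>auto simp: not_le intro: less_imp_le\<close>)
    then show ?thesis using tendsto_minus by fastforce
  qed
  then obtain l where l: "(u \<longlongrightarrow> l) at_top" by blast
  have l0: "0 \<le> l" by (rule tendsto_lowerbound[OF l]) (auto intro!: always_eventually less_imp_le pos)
  have lK: "l \<le> K" by (rule tendsto_upperbound[OF l]) (auto intro!: always_eventually leK)
  \<comment> \<open>The limit energy is nonpositive and lies below the nonnegative energy for
    \<open>V x\<close>, so the gap between them bounds its absolute value.\<close>
  have E0: "(E v\<^sub>1 u w \<longlongrightarrow> 0) at_top"
  proof (rule Lim_null_comparison)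
    show "eventually (\<lambda>x. norm (E v\<^sub>1 u w x) \<le> L * (v\<^sub>1 - V x) * K) at_top"
    proof (intro always_eventually allI)
      fix x
      have "En u w x - E v\<^sub>1 u w x \<le> L * (v\<^sub>1 - V x) * u x"
        using Phi_potential_diff[OF V_bounds, of "u x" x] pos[of x] by (simp add: E_def)
      also have "\<dots> \<le> L * (v\<^sub>1 - V x) * K"
        using L_pos V_bounds(2)[of x] leK[of x] by (intro mult_left_mono) auto
      finally show "norm (E v\<^sub>1 u w x) \<le> L * (v\<^sub>1 - V x) * K" using En[of x] E[of x] by simp
    qed
    show "((\<lambda>x. L * (v\<^sub>1 - V x) * K) \<longlongrightarrow> 0) at_top" by (auto intro!: tendsto_eq_intros V_lim_top)
  qed
  have "isCont (\<Phi> v\<^sub>1) l" using Phi_deriv[OF v1_bounds] by (rule DERIV_isCont)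
  then have "((\<lambda>x. 2 * E v\<^sub>1 u w x + 2 * \<Phi> v\<^sub>1 (u x)) \<longlongrightarrow> 2 * 0 + 2 * \<Phi> v\<^sub>1 l) at_top"
    by (intro tendsto_intros E0 isCont_tendsto_compose[OF _ l])
  then have w2: "((\<lambda>x. (w x)\<^sup>2) \<longlongrightarrow> 2 * \<Phi> v\<^sub>1 l) at_top" by (simp add: E_def)
  have Phi_l: "\<not> 0 < \<Phi> v\<^sub>1 l"
  proof
    assume "0 < \<Phi> v\<^sub>1 l"
    then have "eventually (\<lambda>x. \<Phi> v\<^sub>1 l < (w x)\<^sup>2) at_top" by (intro order_tendstoD(1)[OF w2]) simp
    then have "eventually (\<lambda>x. sqrt (\<Phi> v\<^sub>1 l) \<le> \<bar>w x\<bar>) at_top"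
      by eventually_elim (metis less_imp_le real_sqrt_abs real_sqrt_le_mono)
    from deriv_not_bounded_away_if_convergent[OF l solD(1)[OF s] this] \<open>0 < \<Phi> v\<^sub>1 l\<close> show False by simp
  qed
  have "l \<noteq> K"
  proof
    assume "l = K"
    then have "((\<lambda>x. \<bar>w x\<bar>) \<longlongrightarrow> 0) at_top" using tendsto_real_sqrt[OF w2] by (simp add: Phi_K)
    then have w0: "(w \<longlongrightarrow> 0) at_top" by (simp add: tendsto_rabs_zero_iff)
    \<comment> \<open>Within this distance of \<open>K\<close> the Lipschitz bound keeps the force
      below half its negative value at \<open>K\<close>.\<close>
    have "0 < - g v\<^sub>1 K / (2 * L)" using g_K_neg L_pos by (intro divide_pos_pos) auto
    from tendstoD[OF l this] have "eventually (\<lambda>x. \<bar>u x - K\<bar> < - g v\<^sub>1 K / (2 * L)) at_top"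
      by (simp only: \<open>l = K\<close> dist_real_def)
    then have "eventually (\<lambda>x. - g v\<^sub>1 K / 2 \<le> \<bar>g (V x) (u x)\<bar>) at_top"
    proof eventually_elim
      case (elim x)
      then have "L * \<bar>u x - K\<bar> \<le> - g v\<^sub>1 K / 2" using L_pos by (simp add: field_simps)
      then have "g v\<^sub>1 (u x) \<le> g v\<^sub>1 K / 2" using g_lipschitz[OF v1_bounds, of "u x" K] by linarith
      then show ?case using g_mono[OF V_bounds(2), of x "u x"] by linarith
    qed
    from deriv_not_bounded_away_if_convergent[OF w0 solD(2)[OF s] this] g_K_neg show False by simp
  qed
  then have "l = 0" using Phi_l Phi_pos[of l] l0 lK by force
  with l show ?thesis by simp
qed

theorem homoclinic_solution:
  "\<exists>u w. sol u w \<and> (\<forall>x. 0 < u x \<and> u x \<le> K) \<and> (u \<longlongrightarrow> 0) at_infinity"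
proof -
  have "\<exists>u w. sol u w \<and> (\<forall>x. 0 < u x \<and> 0 \<le> En u w x \<and> E v\<^sub>1 u w x \<le> 0)"
  proof (cases "V 0 < v\<^sub>1")
    case False
    have "V x = v\<^sub>1" for x
    proof (rule antisym[OF V_bounds(2)])
      have "V 0 \<le> V x" using V_mono[OF order.refl, of x] V_antimono[OF _ order.refl, of x] linear by blast
      with False show "v\<^sub>1 \<le> V x" by simp
    qed
    then show ?thesis by (rule homoclinic_exists_constant)
  qed (rule homoclinic_exists_well)
  then obtain u w where u: "sol u w" "\<And>x. 0 < u x" "\<And>x. 0 \<le> En u w x" "\<And>x. E v\<^sub>1 u w x \<le> 0" by blast
  interpret R: scalar_problem g \<Phi> "\<lambda>x. V (- x)" v\<^sub>0 v\<^sub>1 L K s\<^sub>0 a \<mu> B by (rule reflected)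
  have "((\<lambda>x. u (- x)) \<longlongrightarrow> 0) at_top"
  proof (rule R.homoclinic_tendsto_0[OF sol_reflect[OF u(1)]])
    fix x
    show "0 < u (- x)" by (rule u(2))
    show "0 \<le> R.En (\<lambda>x. u (- x)) (\<lambda>x. - w (- x)) x" using u(3)[of "- x"] by (simp add: R.E_def E_def)
    show "R.E v\<^sub>1 (\<lambda>x. u (- x)) (\<lambda>x. - w (- x)) x \<le> 0" using u(4)[of "- x"] by (simp add: R.E_def E_def)
  qed
  then have "(u \<longlongrightarrow> 0) at_bot" by (simp add: filterlim_at_bot_mirror)
  moreover have "(u \<longlongrightarrow> 0) at_top" by (rule homoclinic_tendsto_0[OF u])
  ultimately have "(u \<longlongrightarrow> 0) at_infinity" by (simp add: at_infinity_eq_at_top_bot filterlim_sup)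
  then show ?thesis using u u_le_K by blast
qed

end


section \<open>The Pucci nonlinearity\<close>

text \<open>The inverse of a Pucci operator: slopes \<open>1 / Lam\<close> and
  \<open>1 / lam\<close> invert the maximal one, and exchanging the two slopes inverts the minimal
  one.\<close>

definition two_slope :: "real \<Rightarrow> real \<Rightarrow> real \<Rightarrow> real" where
  "two_slope \<alpha> \<beta> t = (if t \<ge> 0 then \<alpha> * t else \<beta> * t)"

lemma two_slope_0 [simp]: "two_slope \<alpha> \<beta> 0 = 0"
  by (simp add: two_slope_def)

lemma two_slope_mono:
  assumes "0 < \<alpha>" "0 < \<beta>" "s \<le> t"
  shows "two_slope \<alpha> \<beta> s \<le> two_slope \<alpha> \<beta> t"
proof (cases "s < 0 \<and> 0 \<le> t")
  case True
  then have "\<beta> * s \<le> 0" "0 \<le> \<alpha> * t" using assms by (auto simp: mult_le_0_iff)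
  with True show ?thesis by (simp add: two_slope_def)
qed (use assms in \<open>auto simp: two_slope_def\<close>)

lemma two_slope_neg_iff: "0 < \<alpha> \<Longrightarrow> 0 < \<beta> \<Longrightarrow> two_slope \<alpha> \<beta> t < 0 \<longleftrightarrow> t < 0"
  by (auto simp: two_slope_def mult_less_0_iff)

lemma two_slope_lipschitz:
  assumes "0 < \<alpha>" "0 < \<beta>"
  shows "\<bar>two_slope \<alpha> \<beta> s - two_slope \<alpha> \<beta> t\<bar> \<le> (\<alpha> + \<beta>) * \<bar>s - t\<bar>"
proof -
  have *: "two_slope \<alpha> \<beta> t - two_slope \<alpha> \<beta> s \<le> (\<alpha> + \<beta>) * (t - s)" if "s \<le> t" for s t
  proof -
    have "0 \<le> \<beta> * (t - s)" "0 \<le> \<alpha> * (t - s)" using assms that by auto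
    moreover have "0 \<le> \<alpha> * t" if "0 \<le> t" using that assms by simp
    moreover have "\<beta> * t \<le> 0" "\<alpha> * t \<le> 0" if "t < 0" using that assms by (auto simp: mult_le_0_iff)
    moreover have "0 \<le> \<beta> * s" "0 \<le> \<alpha> * s" if "0 \<le> s" using that assms by auto
    moreover have "\<alpha> * s \<le> 0" "\<beta> * s \<le> 0" if "s < 0" using that assms by (auto simp: mult_le_0_iff)
    moreover have "0 \<le> \<beta> * t" if "0 \<le> t" using that assms by simp
    ultimately show ?thesis by (cases "0 \<le> s"; cases "0 \<le> t") (auto simp: two_slope_def algebra_simps)
  qed
  show ?thesis
  proof (cases "s \<le> t")
    case True
    then show ?thesis using *[OF True] two_slope_mono[OF assms True] by (simp add: abs_if algebra_simps)
  next
    case False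
    then have le: "t \<le> s" by simp
    then show ?thesis using *[OF le] two_slope_mono[OF assms le] by (simp add: abs_if algebra_simps)
  qed
qed

lemma two_slope_continuous:
  assumes "0 < \<alpha>" "0 < \<beta>"
  shows "continuous_on S (two_slope \<alpha> \<beta>)"
proof -
  have "(\<alpha> + \<beta>)-lipschitz_on S (two_slope \<alpha> \<beta>)"
    by (rule lipschitz_onI) (use two_slope_lipschitz[OF assms] assms in \<open>auto simp: dist_real_def\<close>)
  then show ?thesis by (rule lipschitz_on_continuous_on)
qed

text \<open>The first zero \<open>K\<close> of the primitive of the limit nonlinearity bounds every solution that
  is homoclinic to zero.\<close>

lemma first_zero_of_primitive:
  fixes f :: "real \<Rightarrow> real"
  assumes \<alpha>: "0 < \<alpha>" "0 < \<beta>" and f: "continuous_on UNIV f" and v: "0 < v"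
    and s0: "0 < s\<^sub>0" "\<And>s. 0 < s \<Longrightarrow> s \<le> s\<^sub>0 \<Longrightarrow> f s < v * s"
    and sup: "filterlim (\<lambda>s. f s / s) at_top at_top"
  defines "P \<equiv> prim (\<lambda>s. two_slope \<alpha> \<beta> (v * s - f s))"
  obtains K where "s\<^sub>0 < K" "P K = 0" "\<And>s. 0 < s \<Longrightarrow> s < K \<Longrightarrow> 0 < P s"
proof -
  let ?g = "\<lambda>s. two_slope \<alpha> \<beta> (v * s - f s)"
  have "continuous_on UNIV ?g"
    by (intro continuous_on_compose2[OF two_slope_continuous[OF \<alpha>, of UNIV]] continuous_intros f) auto
  note P = prim[OF this, folded P_def]
  have Pc: "continuous_on S P" for S by (meson DERIV_continuous_on DERIV_subset P(2) subset_UNIV)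
  have small: "0 < P s" if "0 < s" "s \<le> s\<^sub>0" for s
  proof -
    have "P 0 < P s"
    proof (rule DERIV_pos_imp_increasing_open[OF that(1)])
      fix t assume "0 < t" "t < s"
      then have "0 < ?g t" using s0(2)[of t] that \<alpha> by (simp add: two_slope_def)
      then show "\<exists>d. (P has_real_derivative d) (at t) \<and> 0 < d" using P(2) by blast
    qed (rule Pc)
    then show ?thesis by (simp add: P)
  qed
  \<comment> \<open>Superlinearity is used with one unit to spare, so that from \<open>S\<close> on
    the argument of the two-slope function is at most \<open>- S\<close> and the primitive falls at
    rate at least \<open>\<beta> * S\<close>.\<close>
  have "eventually (\<lambda>s. v + 1 \<le> f s / s) at_top" using sup by (simp add: filterlim_at_top)
  then obtain S' where S': "\<And>s. S' \<le> s \<Longrightarrow> v + 1 \<le> f s / s" by (auto simp: eventually_at_top_linorder)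
  define S where "S = max S' s\<^sub>0"
  have S: "s\<^sub>0 \<le> S" "0 < S" using s0 by (auto simp: S_def)
  have gS: "?g s \<le> - \<beta> * S" if "S \<le> s" for s
  proof -
    have "v + 1 \<le> f s / s" using S' that by (simp add: S_def)
    moreover have "0 < s" using S that by simp
    ultimately have "(v + 1) * s \<le> f s" by (simp add: field_simps)
    then have le: "v * s - f s \<le> - S" using that by (simp add: algebra_simps)
    then have "\<beta> * (v * s - f s) \<le> \<beta> * - S" using \<alpha> by (intro mult_left_mono) auto
    then show ?thesis using le S by (simp add: two_slope_def)
  qed
  \<comment> \<open>Long enough for a descent at that rate to use up \<open>P S\<close> and one unit
    more.\<close>
  define T where "T = (\<bar>P S\<bar> + 1) / (\<beta> * S)"
  have T: "0 < T" "\<beta> * S * T = \<bar>P S\<bar> + 1" using \<alpha> S by (auto simp: T_def)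
  have "P (S + T) \<le> P S + - \<beta> * S * (S + T - S)"
  proof (rule DERIV_mono_le[of S "S + T" P "\<lambda>s. P S + - \<beta> * S * (s - S)" ?g "\<lambda>_. - \<beta> * S"])
    show "((\<lambda>s. P S + - \<beta> * S * (s - S)) has_real_derivative - \<beta> * S) (at t)" for t
      by (auto intro!: derivative_eq_intros)
  qed (use T P(2) gS in auto)
  then have Z: "P (S + T) < 0" using T by simp
  let ?N = "{s\<^sub>0..S + T} \<inter> P -` {..0}"
  have "compact ?N" by (rule closedin_compact[OF compact_Icc continuous_closedin_preimage[OF Pc closed_atMost]])
  moreover have "S + T \<in> ?N" using Z S T by simp
  ultimately obtain K where K: "K \<in> ?N" "\<And>s. s \<in> ?N \<Longrightarrow> K \<le> s"
    using compact_attains_inf[of ?N] by blast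
  have "K \<noteq> s\<^sub>0" using K(1) small[of s\<^sub>0] s0 by auto
  then have sK: "s\<^sub>0 < K" using K(1) by auto
  have pos: "0 < P s" if "0 < s" "s < K" for s
  proof (cases "s \<le> s\<^sub>0")
    case False
    then show ?thesis using K(2)[of s] K(1) that by force
  qed (use small that in simp)
  have "P K = 0"
  proof (rule ccontr)
    assume "P K \<noteq> 0"
    then have "P K < 0" using K(1) by auto
    then obtain t where t: "s\<^sub>0 \<le> t" "t \<le> K" "P t = 0"
      using IVT2'[of P K 0 s\<^sub>0] Pc small[of s\<^sub>0] s0 sK by auto
    then have "t < K" using \<open>P K \<noteq> 0\<close> by (cases "t = K") auto
    then show False using pos[of t] t s0 by simp
  qed
  from that[OF sK this pos] show ?thesis .
qed

text \<open>Projecting heights onto \<open>[0, K]\<close> by \<open>\<tau>\<close> makes the force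
  globally Lipschitz. The solution found stays between 0 and \<open>K\<close>, where the projection
  is the identity, so it solves the original equation.\<close>

lemma positive_solution_exists:
  fixes f V :: "real \<Rightarrow> real"
  assumes \<alpha>: "0 < \<alpha>" "0 < \<beta>"
    and f: "f C1_differentiable_on UNIV" "\<And>s. s \<le> 0 \<Longrightarrow> f s = 0"
    and inf: "((\<lambda>s. f s / s) \<longlongrightarrow> 0) (at_right 0)" and sup: "filterlim (\<lambda>s. f s / s) at_top at_top"
    and incr: "strict_mono_on {0<..} (\<lambda>s. f s / s)"
    and V: "\<And>x y. \<bar>V x - V y\<bar> \<le> B * \<bar>x - y\<bar>" "0 < V 0"
      "\<And>x y. x \<le> y \<Longrightarrow> y \<le> 0 \<Longrightarrow> V y \<le> V x" "\<And>x y. 0 \<le> x \<Longrightarrow> x \<le> y \<Longrightarrow> V x \<le> V y"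
      "(V \<longlongrightarrow> v\<^sub>1) at_top" "(V \<longlongrightarrow> v\<^sub>1) at_bot"
  shows "\<exists>u. C2_real u \<and> (\<forall>x. deriv (deriv u) x = two_slope \<alpha> \<beta> (V x * u x - f (u x))) \<and>
    (\<forall>x. 0 < u x) \<and> (u \<longlongrightarrow> 0) at_infinity"
proof -
  define v\<^sub>0 where "v\<^sub>0 = V 0"
  have v0: "0 < v\<^sub>0" using V(2) by (simp add: v\<^sub>0_def)
  have V_ge: "v\<^sub>0 \<le> V x" for x
    unfolding v\<^sub>0_def using V(3)[of x 0] V(4)[of 0 x] linear[of x 0] by blast
  have V_le: "V x \<le> v\<^sub>1" for x
  proof (cases "0 \<le> x")
    case True
    show ?thesis
      by (rule tendsto_lowerbound[OF V(5)])
        (use V(4)[OF True] in \<open>auto intro: eventually_mono[OF eventually_ge_at_top[of x]]\<close>)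
  next
    case False
    then have "x \<le> 0" by simp
    then show ?thesis
      by (intro tendsto_lowerbound[OF V(6)] eventually_mono[OF eventually_le_at_bot[of x]] V(3)) auto
  qed
  have v1: "v\<^sub>0 \<le> v\<^sub>1" using V_ge[of 0] V_le[of 0] by simp
  obtain f' where f': "\<And>x. (f has_real_derivative f' x) (at x)" "continuous_on UNIV f'"
    using f(1) by (auto simp: C1_differentiable_on_def has_real_derivative_iff_has_vector_derivative)
  have fc: "continuous_on S f" for S by (meson DERIV_continuous_on DERIV_subset f'(1) subset_UNIV)
  have "eventually (\<lambda>s. f s / s < v\<^sub>0 / 2) (at_right 0)" using v0 by (intro order_tendstoD(2)[OF inf]) simp
  then obtain \<delta> where \<delta>: "0 < \<delta>" "\<And>s. 0 < s \<Longrightarrow> s < \<delta> \<Longrightarrow> f s / s < v\<^sub>0 / 2"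
    by (auto simp: eventually_at_right_field)
  define s\<^sub>0 where "s\<^sub>0 = \<delta> / 2"
  have s0: "0 < s\<^sub>0" using \<delta> by (simp add: s\<^sub>0_def)
  \<comment> \<open>Half of \<open>v\<^sub>0\<close> is kept in reserve: for every admissible
    potential the argument of the two-slope function is at least \<open>v\<^sub>0 / 2 * s\<close>.
    Hence only the slope \<open>\<alpha>\<close> acts at these heights, and the growth rate is
    \<open>sqrt (\<alpha> * (v\<^sub>0 / 2))\<close>.\<close>
  have f_small: "f s \<le> v\<^sub>0 / 2 * s" if "0 \<le> s" "s \<le> s\<^sub>0" for s
    using \<delta>(2)[of s] \<delta>(1) f(2)[of 0] that by (cases "s = 0") (auto simp: s\<^sub>0_def divide_less_eq)
  have f_small': "f s < v\<^sub>1 * s" if "0 < s" "s \<le> s\<^sub>0" for s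
  proof -
    have "v\<^sub>0 / 2 * s < v\<^sub>1 * s" using that v0 v1 by (intro mult_strict_right_mono) auto
    with f_small[of s] that show ?thesis by (intro le_less_trans[of "f s" "v\<^sub>0 / 2 * s"]) auto
  qed
  \<comment> \<open>The primitive of the untruncated limit force: \<open>K\<close> has to be known
    before the truncation at \<open>K\<close> can be made, and both primitives agree on
    \<open>[0, K]\<close>.\<close>
  define P where "P = prim (\<lambda>s. two_slope \<alpha> \<beta> (v\<^sub>1 * s - f s))"
  have "0 < v\<^sub>1" using v0 v1 by simp
  from first_zero_of_primitive[OF \<alpha> fc this s0 f_small' sup, folded P_def]
  obtain K where K: "s\<^sub>0 < K" "P K = 0" "\<And>s. 0 < s \<Longrightarrow> s < K \<Longrightarrow> 0 < P s" by blast
  define \<tau> where "\<tau> s = max 0 (min K s)" for s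
  have \<tau>: "0 \<le> \<tau> s" "\<tau> s \<le> K" "\<bar>\<tau> s - \<tau> t\<bar> \<le> \<bar>s - t\<bar>" for s t using K(1) s0 by (auto simp: \<tau>_def)
  have \<tau>_id: "\<tau> s = s" if "0 \<le> s" "s \<le> K" for s using that by (simp add: \<tau>_def)
  have \<tau>c: "continuous_on S \<tau>" for S unfolding \<tau>_def[abs_def] by (intro continuous_intros)
  define g where "g v s = two_slope \<alpha> \<beta> (v * \<tau> s - f (\<tau> s))" for v s
  have gc: "continuous_on UNIV (g v)" for v
    unfolding g_def[abs_def]
    by (intro continuous_on_compose2[OF two_slope_continuous[OF \<alpha>, of UNIV]] continuous_intros \<tau>c
        continuous_on_compose2[OF fc[of UNIV]]) auto
  note Phi = prim[OF gc]
  obtain F where F: "\<And>s. 0 \<le> s \<Longrightarrow> s \<le> K \<Longrightarrow> \<bar>f' s\<bar> \<le> F"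
  proof -
    have "bounded (f' ` {0..K})"
      by (intro compact_imp_bounded compact_continuous_image continuous_on_subset[OF f'(2)]) auto
    then show ?thesis using that unfolding bounded_iff by (metis atLeastAtMost_iff imageI real_norm_def)
  qed
  have F0: "0 \<le> F" using F[of 0] K(1) s0 by simp
  have f_lip: "\<bar>f s - f t\<bar> \<le> F * \<bar>s - t\<bar>" if "0 \<le> s" "s \<le> K" "0 \<le> t" "t \<le> K" for s t
    using field_differentiable_bound[of "{0..K}" f f' F s t] that F DERIV_subset[OF f'(1)] by auto
  \<comment> \<open>One constant for both variables: \<open>v\<^sub>1 + F\<close> covers changes of
    height, and \<open>K\<close>, the bound for \<open>\<tau>\<close>, covers changes of
    potential.\<close>
  define L where "L = (\<alpha> + \<beta>) * (v\<^sub>1 + F + K)"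
  have Lpos: "0 < L" unfolding L_def using \<alpha> v0 v1 F0 K(1) s0 by (intro mult_pos_pos) auto
  have g_lip: "\<bar>g v s - g v t\<bar> \<le> L * \<bar>s - t\<bar>" if "v\<^sub>0 \<le> v" "v \<le> v\<^sub>1" for v s t
  proof -
    have "\<bar>v * (\<tau> s - \<tau> t) - (f (\<tau> s) - f (\<tau> t))\<bar> \<le> \<bar>v * (\<tau> s - \<tau> t)\<bar> + \<bar>f (\<tau> s) - f (\<tau> t)\<bar>"
      by (rule abs_triangle_ineq4)
    also have "\<dots> \<le> v\<^sub>1 * \<bar>s - t\<bar> + F * \<bar>s - t\<bar>"
    proof (rule add_mono)
      show "\<bar>v * (\<tau> s - \<tau> t)\<bar> \<le> v\<^sub>1 * \<bar>s - t\<bar>"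
        unfolding abs_mult using that v0 \<tau>(3) by (intro mult_mono) auto
      have "\<bar>f (\<tau> s) - f (\<tau> t)\<bar> \<le> F * \<bar>\<tau> s - \<tau> t\<bar>" by (intro f_lip \<tau>)
      also have "\<dots> \<le> F * \<bar>s - t\<bar>" by (intro mult_left_mono \<tau> F0)
      finally show "\<bar>f (\<tau> s) - f (\<tau> t)\<bar> \<le> F * \<bar>s - t\<bar>" .
    qed
    also have "\<dots> \<le> (v\<^sub>1 + F + K) * \<bar>s - t\<bar>" using K(1) s0 by (simp add: algebra_simps)
    finally have "(\<alpha> + \<beta>) * \<bar>v * (\<tau> s - \<tau> t) - (f (\<tau> s) - f (\<tau> t))\<bar> \<le> L * \<bar>s - t\<bar>"
      unfolding L_def mult.assoc using \<alpha> by (intro mult_left_mono) auto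
    then show ?thesis
      using two_slope_lipschitz[OF \<alpha>, of "v * \<tau> s - f (\<tau> s)" "v * \<tau> t - f (\<tau> t)"]
      by (simp add: g_def algebra_simps)
  qed
  have g_lip_v: "\<bar>g v s - g v' s\<bar> \<le> L * \<bar>v - v'\<bar>" for v v' s
  proof -
    have "\<bar>g v s - g v' s\<bar> \<le> (\<alpha> + \<beta>) * \<bar>(v - v') * \<tau> s\<bar>"
      using two_slope_lipschitz[OF \<alpha>, of "v * \<tau> s - f (\<tau> s)" "v' * \<tau> s - f (\<tau> s)"]
      by (simp add: g_def left_diff_distrib)
    also have "\<dots> \<le> (\<alpha> + \<beta>) * (\<bar>v - v'\<bar> * (v\<^sub>1 + F + K))"
      unfolding abs_mult using \<alpha> \<tau>(1,2)[of s] v0 v1 F0 by (intro mult_left_mono) auto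
    finally show ?thesis by (simp add: L_def mult_ac)
  qed
  have g_small: "g v s = \<alpha> * (v * s - f s) \<and> \<alpha> * (v\<^sub>0 / 2) * s \<le> g v s" if "v\<^sub>0 \<le> v" "0 \<le> s" "s \<le> s\<^sub>0" for v s
  proof -
    have "v\<^sub>0 * s \<le> v * s" using that by (intro mult_right_mono) auto
    then have *: "v\<^sub>0 / 2 * s \<le> v * s - f s" using f_small[OF that(2,3)] by simp
    moreover have "0 \<le> v\<^sub>0 / 2 * s" using v0 that by simp
    ultimately have "g v s = \<alpha> * (v * s - f s)" using K(1) that by (simp add: g_def two_slope_def \<tau>_id)
    moreover have "\<alpha> * (v\<^sub>0 / 2 * s) \<le> \<alpha> * (v * s - f s)" using * \<alpha> by (intro mult_left_mono) auto
    ultimately show ?thesis by simp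
  qed
  have Phi_ge: "\<alpha> * (v\<^sub>0 / 2) * s\<^sup>2 / 2 \<le> prim (g v) s" if "v\<^sub>0 \<le> v" "0 \<le> s" "s \<le> s\<^sub>0" for v s
  proof (rule DERIV_mono_le[of 0 s "\<lambda>s. \<alpha> * (v\<^sub>0 / 2) * s\<^sup>2 / 2" _ "\<lambda>s. \<alpha> * (v\<^sub>0 / 2) * s" "g v"])
    show "((\<lambda>s. \<alpha> * (v\<^sub>0 / 2) * s\<^sup>2 / 2) has_real_derivative \<alpha> * (v\<^sub>0 / 2) * t) (at t)" for t
      by (auto intro!: derivative_eq_intros)
    show "\<alpha> * (v\<^sub>0 / 2) * t \<le> g v t" if "0 \<le> t" "t \<le> s" for t
      using g_small[of v t] that \<open>v\<^sub>0 \<le> v\<close> \<open>s \<le> s\<^sub>0\<close> by (meson order_trans)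
  qed (use that in \<open>auto intro: Phi(2) simp: Phi(1)\<close>)
  have P_deriv: "(P has_real_derivative two_slope \<alpha> \<beta> (v\<^sub>1 * s - f s)) (at s)" for s
    unfolding P_def
    by (intro prim continuous_on_compose2[OF two_slope_continuous[OF \<alpha>, of UNIV]] continuous_intros fc) auto
  have P_0: "P 0 = 0"
    unfolding P_def
    by (intro prim continuous_on_compose2[OF two_slope_continuous[OF \<alpha>, of UNIV]] continuous_intros fc) auto
  have Phi_P: "prim (g v\<^sub>1) s = P s" if "0 \<le> s" "s \<le> K" for s
  proof (rule antisym)
    have eq: "g v\<^sub>1 t = two_slope \<alpha> \<beta> (v\<^sub>1 * t - f t)" if "0 \<le> t" "t \<le> s" for t
      using that \<open>s \<le> K\<close> by (simp add: g_def \<tau>_id)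
    show "prim (g v\<^sub>1) s \<le> P s"
      by (rule DERIV_mono_le[OF \<open>0 \<le> s\<close> _ Phi(2) P_deriv]) (auto simp: Phi(1) P_0 eq)
    show "P s \<le> prim (g v\<^sub>1) s"
      by (rule DERIV_mono_le[OF \<open>0 \<le> s\<close> _ P_deriv Phi(2)]) (auto simp: Phi(1) P_0 eq)
  qed
  interpret scalar_problem g "\<lambda>v. prim (g v)" V v\<^sub>0 v\<^sub>1 L K s\<^sub>0 \<alpha> "sqrt (\<alpha> * (v\<^sub>0 / 2))" B
  proof
    show "g v s = 0" if "s \<le> 0" for v s using that K(1) s0 f(2)[of 0] by (simp add: g_def \<tau>_def)
    show "g v s \<le> g v' s" if "v \<le> v'" for v v' s
      unfolding g_def using that \<tau>(1) by (intro two_slope_mono \<alpha>) (auto intro: mult_right_mono)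
    show "prim (g v) s - prim (g v') s = \<alpha> * (v - v') * s\<^sup>2 / 2"
      if v: "v\<^sub>0 \<le> v" "v \<le> v\<^sub>1" "v\<^sub>0 \<le> v'" "v' \<le> v\<^sub>1" and s: "0 \<le> s" "s \<le> s\<^sub>0" for v v' s
    proof -
      have eq: "g v t = g v' t + \<alpha> * (v - v') * t" if "0 \<le> t" "t \<le> s" for t
        using g_small[of v t] g_small[of v' t] that v s by (simp add: algebra_simps)
      have d: "((\<lambda>s. prim (g v') s + \<alpha> * (v - v') * s\<^sup>2 / 2) has_real_derivative g v' t + \<alpha> * (v - v') * t) (at t)" for t
        by (auto intro!: derivative_eq_intros Phi(2))
      have "prim (g v) s \<le> prim (g v') s + \<alpha> * (v - v') * s\<^sup>2 / 2"
        by (rule DERIV_mono_le[OF s(1) _ Phi(2) d]) (auto simp: Phi(1) eq)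
      moreover have "prim (g v') s + \<alpha> * (v - v') * s\<^sup>2 / 2 \<le> prim (g v) s"
        by (rule DERIV_mono_le[OF s(1) _ d Phi(2)]) (auto simp: Phi(1) eq)
      ultimately show ?thesis by simp
    qed
    show "(sqrt (\<alpha> * (v\<^sub>0 / 2)))\<^sup>2 * s\<^sup>2 / 2 \<le> prim (g v) s" if "v\<^sub>0 \<le> v" "v \<le> v\<^sub>1" "0 \<le> s" "s \<le> s\<^sub>0" for v s
      using Phi_ge[of v s] that \<alpha> v0 by simp
    show "g v s < 0" if v: "v\<^sub>0 \<le> v" "v \<le> v\<^sub>1" and s: "0 < s" "prim (g v) s \<le> 0" for v s
    \<comment> \<open>A nonnegative force at \<open>s\<close> means that the quotient of
      \<open>f\<close> at \<open>\<tau> s\<close> is at most \<open>v\<close>. Monotonicity passes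
      this to all smaller heights, so the primitive has not decreased since the small height
      \<open>t\<close>, where it is positive.\<close>
    proof (rule ccontr)
      assume "\<not> g v s < 0"
      then have "f (\<tau> s) \<le> v * \<tau> s" by (simp add: g_def two_slope_neg_iff \<alpha>)
      moreover have \<tau>s: "0 < \<tau> s" using s K(1) s0 by (simp add: \<tau>_def)
      ultimately have le: "f (\<tau> s) / \<tau> s \<le> v" by (simp add: divide_le_eq)
      have nn: "0 \<le> g v t" if "0 < t" "t \<le> s" for t
      proof -
        have \<tau>t: "0 < \<tau> t" "\<tau> t \<le> \<tau> s" using that K(1) s0 by (auto simp: \<tau>_def)
        have "f (\<tau> t) / \<tau> t \<le> f (\<tau> s) / \<tau> s"
          using strict_mono_onD[OF incr, of "\<tau> t" "\<tau> s"] \<tau>t \<tau>s by (cases "\<tau> t = \<tau> s") auto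
        from order_trans[OF this le] have "f (\<tau> t) \<le> v * \<tau> t" using \<tau>t(1) by (simp add: divide_le_eq)
        then show ?thesis using two_slope_neg_iff[OF \<alpha>, of "v * \<tau> t - f (\<tau> t)"] by (simp add: g_def)
      qed
      define t where "t = min s s\<^sub>0"
      have t: "0 < t" "t \<le> s" "t \<le> s\<^sub>0" using s s0 by (auto simp: t_def)
      have "0 < \<alpha> * (v\<^sub>0 / 2) * t\<^sup>2 / 2" using \<alpha> v0 t by simp
      also have "\<dots> \<le> prim (g v) t" using Phi_ge[of v t] v t by simp
      also have "\<dots> \<le> prim (g v) s"
        by (rule DERIV_nonneg_imp_nondecreasing[OF t(2)]) (use nn t(1) Phi(2) in \<open>meson less_le_trans\<close>)
      finally show False using s(2) by simp
    qed
    show "prim (g v\<^sub>1) K = 0" using Phi_P[of K] K s0 by simp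
    show "0 < prim (g v\<^sub>1) s" if "0 < s" "s < K" for s using Phi_P[of s] K(3)[of s] that by simp
    show "g v\<^sub>1 s = g v\<^sub>1 K" if "K \<le> s" for s using that by (simp add: g_def \<tau>_def)
    show "0 < sqrt (\<alpha> * (v\<^sub>0 / 2))" using \<alpha> v0 by simp
    show "0 < K" using K(1) s0 by simp
    show "(prim (g v) has_real_derivative g v s) (at s)" for v s by (rule Phi(2))
  qed (fact Lpos g_lip g_lip_v Phi(1) \<alpha> s0 V_ge V_le V)+
  obtain u w where u: "sol u w" "\<And>x. 0 < u x" "\<And>x. u x \<le> K" "(u \<longlongrightarrow> 0) at_infinity"
    using homoclinic_solution by blast
  have g_u: "g (V x) (u x) = two_slope \<alpha> \<beta> (V x * u x - f (u x))" for x
    using u(2,3)[of x] by (simp add: g_def \<tau>_id)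
  have du: "deriv u = w" using solD(1)[OF u(1)] by (auto intro!: DERIV_imp_deriv)
  have dw: "deriv w = (\<lambda>x. g (V x) (u x))" using solD(2)[OF u(1)] by (auto intro!: DERIV_imp_deriv)
  have "u C1_differentiable_on UNIV"
    unfolding C1_differentiable_on_def
    using solD(1)[OF u(1)] sol_continuous(2)[OF u(1)]
    by (auto simp: has_real_derivative_iff_has_vector_derivative)
  moreover have "w C1_differentiable_on UNIV"
    unfolding C1_differentiable_on_def
    using solD(2)[OF u(1)] rhs_continuous[OF sol_continuous(1)[OF u(1)] continuous_on_id]
    by (intro exI[of _ "\<lambda>x. g (V x) (u x)"]) (auto simp: has_real_derivative_iff_has_vector_derivative)
  ultimately have "C2_real u" by (simp add: C2_real_def du)
  then show ?thesis using u(2,4) by (intro exI[of _ u]) (auto simp: du dw g_u)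
qed


section \<open>From the Pucci equations to the two-slope equation\<close>

theorem theorem1p1:
  fixes lam Lam Vinf :: real and f V :: "real \<Rightarrow> real"
  assumes ellipticity: "0 < lam" "lam \<le> Lam"
    and f1: "f C1_differentiable_on UNIV" "\<forall>s\<le>0. f s = 0"
    and f2: "\<exists>eta0>0. ((\<lambda>s. s powr (-1 - eta0) * f s) \<longlongrightarrow> 0) (at_right 0)"
    and f3: "filterlim (\<lambda>s. f s / s) at_top at_top"
      "\<exists>fbar :: real \<Rightarrow> real. \<forall>K. compact K \<and> K \<subseteq> {0<..1} \<longrightarrow>
         uniform_limit K (\<lambda>s \<theta>. f (\<theta> * s) / f s) fbar at_top"
    and f4: "strict_mono_on {0<..} (\<lambda>s. f s / s)"
    and V1: "V \<in> W1_inf" "0 < (INF x. V x)"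
    and V2: "AE x in lborel. x < 0 \<longrightarrow> (\<exists>D\<le>0. (V has_real_derivative D) (at x))"
      "AE y in lborel. 0 < y \<longrightarrow> (\<exists>D\<ge>0. (V has_real_derivative D) (at y))"
    and Vinf: "(V \<longlongrightarrow> Vinf) at_infinity" "V 0 \<le> Vinf"
  shows "((\<exists>C0>0. \<exists>xi0>0. \<forall>x. 0 \<le> Vinf - V x \<and>
             Vinf - V x \<le> C0 * exp (- 2 * sqrt (Vinf / Lam + xi0) * \<bar>x\<bar>)) \<longrightarrow>
          (\<exists>u. classical_solution (pucci_plus lam Lam) V f u \<and>
             (\<forall>x. 0 < u x) \<and> (u \<longlongrightarrow> 0) at_infinity)) \<and>
         ((\<exists>C0>0. \<exists>xi0>0. \<forall>x. 0 \<le> Vinf - V x \<and>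
             Vinf - V x \<le> C0 * exp (- 2 * sqrt (Vinf / lam + xi0) * \<bar>x\<bar>)) \<longrightarrow>
          (\<exists>u. classical_solution (pucci_minus lam Lam) V f u \<and>
             (\<forall>x. 0 < u x) \<and> (u \<longlongrightarrow> 0) at_infinity))"
proof -
  obtain L where L: "L-lipschitz_on UNIV V" using V1(1) by (auto simp: W1_inf_def)
  have V_lip: "\<bar>V x - V y\<bar> \<le> L * \<bar>x - y\<bar>" for x y
    using lipschitz_onD[OF L, of x y] by (simp add: dist_real_def)
  have V_cont: "isCont V x" for x
    using lipschitz_on_continuous_on[OF L] by (simp add: continuous_on_eq_continuous_at)
  have "bdd_below (range V)" using V1(1) by (auto simp: W1_inf_def intro: bounded_imp_bdd_below)
  then have V0: "0 < V 0" using V1(2) cINF_lower[of V UNIV 0] by simp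
  have V_lim: "(V \<longlongrightarrow> Vinf) at_top" "(V \<longlongrightarrow> Vinf) at_bot"
    by (rule tendsto_mono[OF at_top_le_at_infinity Vinf(1)], rule tendsto_mono[OF at_bot_le_at_infinity Vinf(1)])
  have mono_pos: "V x \<le> V y" if "0 < x" "x \<le> y" for x y
  proof (rule lipschitz_mono_if_AE_deriv_nonneg[OF L _ that(2)])
    show "AE z in lborel. z \<in> {x..y} \<longrightarrow> (\<exists>D\<ge>0. (V has_real_derivative D) (at z))"
      by (rule eventually_mono[OF V2(2)]) (use that(1) in auto)
  qed
  have antimono_neg: "V y \<le> V x" if "x \<le> y" "y < 0" for x y
  proof -
    have "L-lipschitz_on UNIV (\<lambda>x. - V x)" using L by (simp add: lipschitz_on_def dist_minus)
    moreover have "AE z in lborel. z \<in> {x..y} \<longrightarrow> (\<exists>D\<ge>0. ((\<lambda>x. - V x) has_real_derivative D) (at z))"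
      using V2(1)
    proof eventually_elim
      case (elim z)
      show ?case
      proof
        assume "z \<in> {x..y}"
        then have "z < 0" using \<open>y < 0\<close> by simp
        with elim obtain D where "D \<le> 0" "(V has_real_derivative D) (at z)" by blast
        then show "\<exists>D\<ge>0. ((\<lambda>x. - V x) has_real_derivative D) (at z)"
          by (intro exI[of _ "- D"]) (auto intro: DERIV_minus)
      qed
    qed
    ultimately have "- V x \<le> - V y" using that(1)
      by (rule lipschitz_mono_if_AE_deriv_nonneg[where V = "\<lambda>x. - V x"])
    then show ?thesis by simp
  qed
  \<comment> \<open>The sign of the derivative is given almost everywhere on the open half-line;
    continuity of \<open>V\<close> at 0 adds the endpoint.\<close>
  have mono: "V x \<le> V y" if "0 \<le> x" "x \<le> y" for x y
  proof (cases "x = 0 \<and> 0 < y")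
    case True
    have "(V \<longlongrightarrow> V 0) (at_right 0)"
      using V_cont[of 0] unfolding isCont_def by (rule tendsto_within_subset) simp
    moreover have "eventually (\<lambda>x. V x \<le> V y) (at_right 0)"
      by (rule eventually_mono[OF eventually_at_right_real[of 0 y]]) (use True mono_pos in auto)
    ultimately have "V 0 \<le> V y" by (rule tendsto_upperbound) simp
    then show ?thesis using True by simp
  next
    case False
    with that consider "x = y" | "0 < x" by linarith
    then show ?thesis using mono_pos[OF _ that(2)] by cases auto
  qed
  have antimono: "V y \<le> V x" if "x \<le> y" "y \<le> 0" for x y
  proof (cases "y = 0 \<and> x < 0")
    case True
    have "(V \<longlongrightarrow> V 0) (at_left 0)"
      using V_cont[of 0] unfolding isCont_def by (rule tendsto_within_subset) simp
    moreover have "eventually (\<lambda>y. V y \<le> V x) (at_left 0)"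
      by (rule eventually_mono[OF eventually_at_left_real[of x 0]]) (use True antimono_neg in auto)
    ultimately have "V 0 \<le> V x" by (rule tendsto_upperbound) simp
    then show ?thesis using True by simp
  next
    case False
    with that consider "x = y" | "y < 0" by linarith
    then show ?thesis using antimono_neg[OF that(1)] by cases auto
  qed
  \<comment> \<open>The quotient is \<open>s powr \<eta>\<close> times the expression in
    \<open>f2\<close>, and both factors tend to 0.\<close>
  have quot: "((\<lambda>s. f s / s) \<longlongrightarrow> 0) (at_right 0)"
  proof -
    obtain \<eta> where \<eta>: "\<eta> > 0" "((\<lambda>s. s powr (-1 - \<eta>) * f s) \<longlongrightarrow> 0) (at_right 0)" using f2 by blast
    have "((\<lambda>s::real. s powr \<eta>) \<longlongrightarrow> 0) (at_right 0)"
      by (rule tendsto_zero_powrI[OF tendsto_ident_at tendsto_const])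
        (use \<eta>(1) eventually_at_right_less[of "0::real"] in \<open>auto elim!: eventually_mono\<close>)
    from tendsto_mult[OF this \<eta>(2)]
    have "((\<lambda>s. s powr \<eta> * (s powr (-1 - \<eta>) * f s)) \<longlongrightarrow> 0) (at_right 0)" by (simp only: mult_zero_left)
    moreover have "eventually (\<lambda>s. s powr \<eta> * (s powr (-1 - \<eta>) * f s) = f s / s) (at_right 0)"
      using eventually_at_right_less[of "0::real"]
    proof eventually_elim
      case (elim s)
      then have "s powr \<eta> * s powr (-1 - \<eta>) = 1 / s"
        by (simp add: powr_minus_divide flip: powr_add)
      then show ?case by (simp flip: mult.assoc)
    qed
    ultimately show ?thesis by (rule Lim_transform_eventually)
  qed
  \<comment> \<open>A right inverse suffices: applying \<open>M\<close> to u'' = two_slope(V u -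
    f(u)) returns V u - f(u), which is the equation.\<close>
  have exists: "\<exists>u. classical_solution M V f u \<and> (\<forall>x. 0 < u x) \<and> (u \<longlongrightarrow> 0) at_infinity"
    if ab: "0 < \<alpha>" "0 < \<beta>" and M: "\<And>t. M (two_slope \<alpha> \<beta> t) = t" for \<alpha> \<beta> M
  proof -
    obtain u where u: "C2_real u" "\<And>x. deriv (deriv u) x = two_slope \<alpha> \<beta> (V x * u x - f (u x))"
      "\<And>x. 0 < u x" "(u \<longlongrightarrow> 0) at_infinity"
      using positive_solution_exists[OF ab f1(1) _ quot f3(1) f4 V_lip V0 antimono mono V_lim] f1(2) by blast
    then show ?thesis by (intro exI[of _ u]) (auto simp: classical_solution_def M)
  qed
  have "pucci_plus lam Lam (two_slope (1 / Lam) (1 / lam) t) = t"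
    "pucci_minus lam Lam (two_slope (1 / lam) (1 / Lam) t) = t" for t
    using ellipticity by (auto simp: pucci_plus_def pucci_minus_def two_slope_def divide_simps)
  then show ?thesis
    using ellipticity exists[of "1 / Lam" "1 / lam" "pucci_plus lam Lam"]
      exists[of "1 / lam" "1 / Lam" "pucci_minus lam Lam"] by simp
qed

end
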